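(* There exists an algorithm which, given as input an integral matrix $A\in\mathbb{Z}^{d\times n}$ whose cone $\operatorname{cone}(A)$ is pointed, computes a finite explicit representation of the set $H$ of holes of the semigroup $Q$ generated by the columns of $A$. That is, the algorithm computes a finite index set $I$, vectors $h_i\in\mathbb{Z}^d$ ($i\in I$), and monoids $M_i\subseteq\mathbb{Z}^d$ ($i\in I$), each $M_i$ given by a finite set of generators in $\mathbb{Z}^d$, such that \[ H=\bigcup_{i\in I}\left(\{h_i\}+M_i\right). \]
   Context: Let $A\in\mathbb{Z}^{d\times n}$ have columns $A_{.1},\dots,A_{.n}$, and let $\mathbb{Z}_+$ denote the nonnegative integers. The semigroup generated by the columns is $Q=\{A\lambda:\lambda\in\mathbb{Z}_+^n\}$ (it contains $0$). Let $\operatorname{cone}(A)=\{A\lambda:\lambda\in\mathbb{R}^n,\ \lambda\ge 0\}$ and $\operatorname{lattice}(A)=\{A\lambda:\lambda\in\mathbb{Z}^n\}$. The saturation of $Q$ is $Q_{\mathrm{sat}}=\operatorname{cone}(A)\cap\operatorname{lattice}(A)$. Standing assumption: $\operatorname{cone}(A)$ is pointed (contains no line). The set of holes of $Q$ is $H=Q_{\mathrm{sat}}\setminus Q$; it may be empty, finite or infinite. A monoid $M_i$ is a subset of $\mathbb{Z}^d$ of the form of all nonnegative integer combinations of finitely many generators; it may be trivial, $M_i=\{0\}$. The union need not be disjoint. *)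

theory Defs
  imports "Jordan_Normal_Form.Matrix" "HOL-Library.Nat_Bijection"
begin

definition monoid_of :: "int mat \<Rightarrow> int vec set" where
  "monoid_of A = {A *\<^sub>v l | l. l \<in> carrier_vec (dim_col A) \<and> (\<forall>j < dim_col A. 0 \<le> l $ j)}"

definition cone_of :: "int mat \<Rightarrow> real vec set" where
  "cone_of A = {map_mat real_of_int A *\<^sub>v l | l.
     l \<in> carrier_vec (dim_col A) \<and> (\<forall>j < dim_col A. 0 \<le> l $ j)}"

definition lattice_of :: "int mat \<Rightarrow> int vec set" where
  "lattice_of A = {A *\<^sub>v l | l. l \<in> carrier_vec (dim_col A)}"

definition saturation :: "int mat \<Rightarrow> int vec set" where
  "saturation A = {z \<in> lattice_of A. map_vec real_of_int z \<in> cone_of A}"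

definition holes :: "int mat \<Rightarrow> int vec set" where
  "holes A = saturation A - monoid_of A"

definition pointed :: "nat \<Rightarrow> real vec set \<Rightarrow> bool" where
  "pointed d C \<longleftrightarrow> \<not> (\<exists>a \<in> carrier_vec d. \<exists>v \<in> carrier_vec d. v \<noteq> 0\<^sub>v d \<and>
     (\<forall>t::real. a + t \<cdot>\<^sub>v v \<in> C))"

text \<open>A representation is the list of pairs of a shift vector and a list of monoid generators;
  the positions in the list form the finite index set.  An empty list of generators yields
  the trivial monoid.\<close>

type_synonym representation = "(int vec \<times> int vec list) list"

definition well_dim :: "nat \<Rightarrow> representation \<Rightarrow> bool" where
  "well_dim d R \<longleftrightarrow> (\<forall>(h, G) \<in> set R. h \<in> carrier_vec d \<and> set G \<subseteq> carrier_vec d)"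

definition represented :: "nat \<Rightarrow> representation \<Rightarrow> int vec set" where
  "represented d R = (\<Union>(h, G) \<in> set R. {h + m | m. m \<in> monoid_of (mat_of_cols d G)})"

text \<open>Algorithms are modelled as Kleene's partial recursive functions.  Terms carry no arity:
  applied to an argument list of length \<open>k\<close>, a term denotes a \<open>k\<close>-ary partial recursive
  function, which is undefined where a required argument is missing.\<close>

datatype recf =
    Zero
  | Succ
  | Proj nat
  | Comp recf "recf list"
  | PrimRec recf recf
  | Mu recf

primrec run :: "recf \<Rightarrow> nat list \<Rightarrow> nat option" where
  "run Zero = (\<lambda>xs. Some 0)"
| "run Succ = (\<lambda>xs. case xs of [] \<Rightarrow> None | x # _ \<Rightarrow> Some (Suc x))"
| "run (Proj i) = (\<lambda>xs. if i < length xs then Some (xs ! i) else None)"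
| "run (Comp f gs) = (\<lambda>xs.
     let rs = map (\<lambda>g. run g xs) gs
     in if None \<in> set rs then None else run f (map the rs))"
| "run (PrimRec f g) = (\<lambda>xs. case xs of [] \<Rightarrow> None | n # ys \<Rightarrow>
     rec_nat (run f ys) (\<lambda>k r. Option.bind r (\<lambda>v. run g (k # v # ys))) n)"
| "run (Mu f) = (\<lambda>xs.
     let zero_at = (\<lambda>y. run f (y # xs) = Some 0 \<and> (\<forall>z<y. \<exists>v. run f (z # xs) = Some (Suc v)))
     in if \<exists>y. zero_at y then Some (THE y. zero_at y) else None)"

definition encode_vec :: "int vec \<Rightarrow> nat" where
  "encode_vec v = list_encode (map int_encode (list_of_vec v))"

definition encode_vecs :: "int vec list \<Rightarrow> nat" where
  "encode_vecs vs = list_encode (map encode_vec vs)"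

text \<open>The number of rows is passed explicitly: it cannot be recovered from the columns
  when there are none.\<close>

definition encode_input :: "int mat \<Rightarrow> nat list" where
  "encode_input A = [dim_row A, encode_vecs (cols A)]"

definition encode_output :: "representation \<Rightarrow> nat" where
  "encode_output R = list_encode (map (\<lambda>(h, G). prod_encode (encode_vec h, encode_vecs G)) R)"

lemma inj_encode_vec: "inj encode_vec"
  by (rule injI) (metis encode_vec_def inj_int_encode inj_list_encode inj_map_eq_map inj_eq vec_list)

lemma inj_encode_vecs: "inj encode_vecs"
  by (rule injI) (metis encode_vecs_def inj_encode_vec inj_list_encode inj_map_eq_map inj_eq)

lemma inj_encode_output: "inj encode_output"
proof -
  have "inj (\<lambda>(h, G). prod_encode (encode_vec h, encode_vecs G))"
    by (auto simp: inj_def inj_eq[OF inj_prod_encode] inj_eq[OF inj_encode_vec] inj_eq[OF inj_encode_vecs])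
  then show ?thesis
    by (intro injI) (simp add: encode_output_def inj_eq[OF inj_list_encode] inj_map_eq_map)
qed

lemma inj_encode_input: "inj encode_input"
  by (rule injI) (metis encode_input_def inj_encode_vecs inj_eq list.inject mat_of_cols_cols)

end

theory Submission
  imports Defs "HOL-Library.More_List"
begin

text \<open>
  Every point of the saturation is \<open>p + q\<close> with \<open>q\<close> in the semigroup \<open>Q\<close> and \<open>p\<close> in a finite box
  (reduce the coefficients of a rational representation modulo 1).  For fixed \<open>p\<close> the exponents \<open>\<lambda>\<close>
  with \<open>p + A\<lambda> \<in> Q\<close> form an up-set, so by Dickson's lemma membership depends only on \<open>min \<lambda> B\<close>
  for some \<open>B\<close>; its complement is then the union of the sets \<open>c + \<nat>\<^sup>S\<close>, where \<open>c\<close> is bounded by \<open>B\<close>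
  and \<open>S = {j. c\<^sub>j = B}\<close>.  A given \<open>B\<close> is good iff finitely many integer programs of the form
  \<open>h + G\<nu> = A\<mu>\<close> are infeasible, so \<open>B\<close> is found by unbounded search.  Feasibility of
  \<open>b = C\<lambda>\<close> over the nonnegative integers is decided by eliminating one coordinate after the other:
  a solution of a single equation is a bounded solution plus homogeneous ones, each supported on one zero
  coefficient or on two coefficients of opposite sign.  The same elimination over the reals
  shows that an integer point of the real cone has a positive multiple in \<open>Q\<close>.
\<close>

section \<open>Computable functions\<close>

text \<open>Dickson's lemma proves that a threshold B exists but gives no formula for it. What saves
  the algorithm is that a good B can be recognised: \<open>separating\<close> is a finite
  conjunction of infeasibility tests, and Dickson's lemma only shows that the search halts. The
  lattice and cone conditions are brought into the same form. An integer vector z is in the lattice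
  iff it lies in the semigroup generated by the columns and their negatives, and it is in the cone
  iff it lies in the semigroup generated by the columns and -z. So one decision procedure,
  \<open>feasible\<close>, answers every question that arises. The mathematics is done on functions
  from \<open>nat\<close> to \<open>int\<close>, where no dimension has to be carried along; the
  program works on integer lists, whose codes agree with the prescribed codes of vectors. The
  function \<open>coord\<close> links the two levels.\<close>

class enc =
  fixes enc :: "'a \<Rightarrow> nat"

instantiation nat :: enc
begin
definition enc_nat_def [simp]: "enc (n::nat) = n"
instance ..
end

instantiation bool :: enc
begin
definition enc_bool_def: "enc (b::bool) = of_bool b"
instance ..
end

instantiation int :: enc
begin
definition enc_int_def: "enc (i::int) = int_encode i"
instance ..
end

instantiation prod :: (enc, enc) enc
begin
definition enc_prod_def: "enc (p::'a \<times> 'b) = prod_encode (enc (fst p), enc (snd p))"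
instance ..
end

instantiation list :: (enc) enc
begin
definition enc_list_def: "enc (xs::'a list) = list_encode (map enc xs)"
instance ..
end

text \<open>A program is held to its result only on codes \<open>enc x\<close>; on other numbers it
  may diverge or return anything. Several arguments are packed into one pair code, so that the
  closure rules deal with a single arity.\<close>

definition computable :: "('a::enc \<Rightarrow> 'b::enc) \<Rightarrow> bool" where
  "computable f \<longleftrightarrow> (\<exists>r. \<forall>x. run r [enc x] = Some (enc (f x)))"

lemma run_Comp:
  assumes "map (\<lambda>g. run g xs) gs = map Some ys"
  shows "run (Comp f gs) xs = run f ys"
proof -
  have "None \<notin> set (map (\<lambda>g. run g xs) gs)"
    unfolding assms by auto
  moreover have "map the (map (\<lambda>g. run g xs) gs) = ys"
    unfolding assms by (simp add: comp_def)
  ultimately show ?thesis by (simp only: run.simps Let_def if_False)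
qed

lemma run_PrimRec:
  assumes "run f ys = Some (h 0)" "\<And>k. k < n \<Longrightarrow> run g (k # h k # ys) = Some (h (Suc k))"
  shows "run (PrimRec f g) (n # ys) = Some (h n)"
proof -
  have "m \<le> n \<Longrightarrow> rec_nat (run f ys) (\<lambda>k r. Option.bind r (\<lambda>v. run g (k # v # ys))) m = Some (h m)" for m
    by (induction m) (use assms in auto)
  then show ?thesis by simp
qed

lemma run_Mu:
  assumes total: "\<And>y. run f (y # xs) = Some (h y)" and "\<exists>y. h y = 0"
  shows "run (Mu f) xs = Some (LEAST y. h y = 0)"
proof -
  have least: "h y = 0 \<and> (\<forall>z<y. \<exists>v. h z = Suc v) \<longleftrightarrow> y = (LEAST y. h y = 0)" for y
    using LeastI_ex[OF assms(2)] not_less_Least[of _ "\<lambda>y. h y = 0"] Least_le[of "\<lambda>y. h y = 0"]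
    by (metis gr0_conv_Suc linorder_neqE_nat neq0_conv not_le)
  show ?thesis by (simp add: total least Let_def)
qed

section \<open>Elementary arithmetic and Cantor's pairing as recursive functions\<close>

definition binary :: "(nat \<Rightarrow> nat \<Rightarrow> nat) \<Rightarrow> bool" where
  "binary f \<longleftrightarrow> (\<exists>r. \<forall>x y. run r [x, y] = Some (f x y))"

definition unary :: "(nat \<Rightarrow> nat) \<Rightarrow> bool" where
  "unary f \<longleftrightarrow> (\<exists>r. \<forall>x. run r [x] = Some (f x))"

lemma unary_id: "unary (\<lambda>x. x)"
  unfolding unary_def by (rule exI[of _ "Proj 0"]) simp

lemma unary_const: "unary (\<lambda>x. c)"
proof (induction c)
  case 0
  show ?case unfolding unary_def by (rule exI[of _ Zero]) simp
next
  case (Suc c)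
  then obtain r where "\<forall>x. run r [x] = Some c" unfolding unary_def by blast
  then show ?case unfolding unary_def by (intro exI[of _ "Comp Succ [r]"]) simp
qed

lemma unary_binary:
  assumes "binary h" "unary f" "unary g"
  shows "unary (\<lambda>x. h (f x) (g x))"
proof -
  from assms obtain r s t where "\<forall>x y. run r [x, y] = Some (h x y)" "\<forall>x. run s [x] = Some (f x)"
    "\<forall>x. run t [x] = Some (g x)" unfolding unary_def binary_def by blast
  then show ?thesis unfolding unary_def by (intro exI[of _ "Comp r [s, t]"]) simp
qed

lemma unary_comp:
  assumes "unary h" "unary f" shows "unary (\<lambda>x. h (f x))"
proof -
  from assms obtain r s where "\<forall>x. run r [x] = Some (h x)" "\<forall>x. run s [x] = Some (f x)"
    unfolding unary_def by blast
  then show ?thesis unfolding unary_def by (intro exI[of _ "Comp r [s]"]) simp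
qed

lemma binary_add: "binary (\<lambda>x y. x + y)"
  unfolding binary_def
proof (rule exI, intro allI)
  fix x y
  show "run (PrimRec (Proj 0) (Comp Succ [Proj 1])) [x, y] = Some (x + y)"
    by (rule run_PrimRec[where h = "\<lambda>x. x + y"]) simp_all
qed

lemma binary_mult: "binary (\<lambda>x y. x * y)"
proof -
  obtain a where a: "\<forall>x y. run a [x, y] = Some (x + y)"
    using binary_add unfolding binary_def by blast
  have "run (PrimRec Zero (Comp a [Proj 1, Proj 2])) [x, y] = Some (x * y)" for x y
    by (rule run_PrimRec[where h = "\<lambda>x. x * y"]) (simp_all add: a)
  then show ?thesis unfolding binary_def by blast
qed

lemma unary_pred: "unary (\<lambda>x. x - 1)"
proof -
  have "run (PrimRec Zero (Proj 0)) [x] = Some (x - 1)" for x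
    by (rule run_PrimRec[where h = "\<lambda>x. x - 1"]) simp_all
  then show ?thesis unfolding unary_def by blast
qed

lemma binary_diff: "binary (\<lambda>x y. x - y)"
proof -
  obtain p where p: "\<forall>x. run p [x] = Some (x - 1)"
    using unary_pred unfolding unary_def by blast
  have "run (PrimRec (Proj 0) (Comp p [Proj 1])) [y, x] = Some (x - y)" for x y
    by (rule run_PrimRec[where h = "\<lambda>y. x - y"]) (simp_all add: p)
  then have "run (Comp (PrimRec (Proj 0) (Comp p [Proj 1])) [Proj 1, Proj 0]) [x, y] = Some (x - y)" for x y
    by (subst run_Comp[where ys = "[y, x]"]) simp_all
  then show ?thesis unfolding binary_def by blast
qed

lemma unary_Least:
  assumes h: "binary h" and ex: "\<And>x. \<exists>y. h x y = 0"
  shows "unary (\<lambda>x. LEAST y. h x y = 0)"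
proof -
  obtain r where r: "\<forall>x y. run r [x, y] = Some (h x y)" using h unfolding binary_def by blast
  have "run (Mu (Comp r [Proj 1, Proj 0])) [x] = Some (LEAST y. h x y = 0)" for x
    by (rule run_Mu) (use ex in \<open>simp_all add: r\<close>)
  then show ?thesis unfolding unary_def by blast
qed

lemma binary_comp1:
  assumes "unary f" "binary h" shows "binary (\<lambda>x y. f (h x y))"
proof -
  from assms obtain r s where "\<forall>x. run r [x] = Some (f x)" "\<forall>x y. run s [x, y] = Some (h x y)"
    unfolding unary_def binary_def by blast
  then show ?thesis unfolding binary_def by (intro exI[of _ "Comp r [s]"]) simp
qed

lemma binary_comp2:
  assumes "binary k" "binary g" "binary h" shows "binary (\<lambda>x y. k (g x y) (h x y))"
proof -
  from assms obtain r s t where "\<forall>x y. run r [x, y] = Some (k x y)"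
    "\<forall>x y. run s [x, y] = Some (g x y)" "\<forall>x y. run t [x, y] = Some (h x y)"
    unfolding binary_def by blast
  then show ?thesis unfolding binary_def by (intro exI[of _ "Comp r [s, t]"]) simp
qed

lemma binary_fst: "binary (\<lambda>x y. x)"
  unfolding binary_def by (rule exI[of _ "Proj 0"]) simp

lemma binary_snd: "binary (\<lambda>x y. y)"
  unfolding binary_def by (rule exI[of _ "Proj 1"]) simp

lemma unary_div2: "unary (\<lambda>x. x div 2)"
proof -
  \<comment> \<open>Subtraction on \<open>nat\<close> is truncated, so the condition says
    \<open>x < 2 * (y + 1)\<close>, whose least solution is the quotient.\<close>
  have "unary (\<lambda>x. LEAST y. Suc x - 2 * Suc y = 0)"
  proof (rule unary_Least)
    show "binary (\<lambda>x y. Suc x - 2 * Suc y)"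
      using binary_comp2[OF binary_diff binary_comp2[OF binary_add binary_comp1[OF unary_const[of 1] binary_fst] binary_fst]
         binary_comp2[OF binary_mult binary_comp1[OF unary_const[of 2] binary_fst]
           binary_comp2[OF binary_add binary_comp1[OF unary_const[of 1] binary_fst] binary_snd]]]
      by simp
    show "\<exists>y. Suc x - 2 * Suc y = 0" for x by (rule exI[of _ x]) simp
  qed
  moreover have "(LEAST y. Suc x - 2 * Suc y = 0) = x div 2" for x
    by (rule Least_equality) auto
  ultimately show ?thesis by simp
qed

lemma unary_triangle: "unary triangle"
proof -
  have "unary (\<lambda>x. x * (x + 1))"
    by (intro unary_binary[OF binary_mult] unary_binary[OF binary_add] unary_id unary_const)
  then have "unary (\<lambda>x. (x * (x + 1)) div 2)"
    by (rule unary_comp[OF unary_div2])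
  then show ?thesis by (simp add: triangle_def[abs_def])
qed

lemma binary_prod_encode: "binary (\<lambda>x y. prod_encode (x, y))"
  using binary_comp2[OF binary_add binary_comp1[OF unary_triangle binary_comp2[OF binary_add binary_fst binary_snd]] binary_fst]
  by (simp add: prod_encode_def)

lemma triangle_mono: "m \<le> n \<Longrightarrow> triangle m \<le> triangle n"
  by (induction rule: dec_induct) auto

lemma unary_prod_decode: "unary (\<lambda>x. fst (prod_decode x))" "unary (\<lambda>x. snd (prod_decode x))"
proof -
  \<comment> \<open>\<open>prod_encode (a, b)\<close> is \<open>triangle (a + b) + a\<close>, so the
    diagonal a + b is the least y with \<open>x < triangle (y + 1)\<close>. Both components then
    follow by subtraction.\<close>
  let ?s = "\<lambda>x. LEAST y. Suc x - triangle (Suc y) = 0"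
  have s: "unary ?s"
  proof (rule unary_Least)
    show "binary (\<lambda>x y. Suc x - triangle (Suc y))"
      using binary_comp2[OF binary_diff binary_comp2[OF binary_add binary_comp1[OF unary_const[of 1] binary_fst] binary_fst]
         binary_comp1[OF unary_triangle
           binary_comp2[OF binary_add binary_comp1[OF unary_const[of 1] binary_fst] binary_snd]]]
      by simp
    have "x \<le> triangle x" for x by (induction x) auto
    then show "\<exists>y. Suc x - triangle (Suc y) = 0" for x
      by (intro exI[of _ x]) simp
  qed
  have s_eq: "?s x = fst (prod_decode x) + snd (prod_decode x)" for x
  proof -
    obtain a b where ab: "prod_decode x = (a, b)" by fastforce
    then have x: "x = triangle (a + b) + a"
      using prod_decode_inverse[of x] by (simp add: prod_encode_def)
    have "?s x = a + b"
    proof (rule Least_equality)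
      fix y assume "Suc x - triangle (Suc y) = 0"
      then have "\<not> triangle (Suc y) \<le> triangle (a + b)" using x by linarith
      then show "a + b \<le> y" using triangle_mono by (metis not_less_eq_eq)
    qed (simp add: x)
    then show ?thesis by (simp add: ab)
  qed
  have tri: "unary (\<lambda>x. triangle (?s x))"
    by (rule unary_comp[OF unary_triangle s])
  have "unary (\<lambda>x. x - triangle (?s x))" "unary (\<lambda>x. ?s x - (x - triangle (?s x)))"
    by (intro unary_binary[OF binary_diff] unary_id s tri)+
  moreover have fst_eq: "x - triangle (?s x) = fst (prod_decode x)" for x
    unfolding s_eq using prod_decode_inverse[of x] by (simp add: prod_encode_def case_prod_beta)
  ultimately show "unary (\<lambda>x. fst (prod_decode x))" "unary (\<lambda>x. snd (prod_decode x))"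
    by (simp_all only: fst_eq s_eq add_diff_cancel_left')
qed

subsection \<open>Computable functions on encoded data\<close>

lemma computable_id: "computable (\<lambda>x. x)"
  unfolding computable_def by (rule exI[of _ "Proj 0"]) simp

lemma computable_const: "computable (\<lambda>x. c)"
  using unary_const[of "enc c"] unfolding unary_def computable_def by blast

lemma computable_unary:
  assumes "unary h" "computable f" "\<And>x. enc (g x) = h (enc (f x))"
  shows "computable g"
proof -
  from assms obtain r s where "\<forall>x. run r [x] = Some (h x)" "\<forall>x. run s [enc x] = Some (enc (f x))"
    unfolding unary_def computable_def by blast
  then show ?thesis unfolding computable_def by (intro exI[of _ "Comp r [s]"]) (simp add: assms(3))
qed

lemma computable_binary:
  assumes "binary h" "computable f" "computable g" "\<And>x. enc (k x) = h (enc (f x)) (enc (g x))"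
  shows "computable k"
proof -
  from assms obtain r s t where "\<forall>x y. run r [x, y] = Some (h x y)" "\<forall>x. run s [enc x] = Some (enc (f x))"
    "\<forall>x. run t [enc x] = Some (enc (g x))" unfolding binary_def computable_def by blast
  then show ?thesis unfolding computable_def by (intro exI[of _ "Comp r [s, t]"]) (simp add: assms(4))
qed

lemma computable_comp:
  assumes "computable h" "computable f" shows "computable (\<lambda>x. h (f x))"
proof -
  from assms obtain r s where "\<forall>x. run r [enc x] = Some (enc (h x))" "\<forall>x. run s [enc x] = Some (enc (f x))"
    unfolding computable_def by blast
  then show ?thesis unfolding computable_def by (intro exI[of _ "Comp r [s]"]) simp
qed

lemma computable_Pair: "computable f \<Longrightarrow> computable g \<Longrightarrow> computable (\<lambda>x. (f x, g x))"
  by (erule (1) computable_binary[OF binary_prod_encode]) (simp add: enc_prod_def)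

lemma computable_fst: "computable f \<Longrightarrow> computable (\<lambda>x. fst (f x))"
  by (erule computable_unary[OF unary_prod_decode(1)]) (simp add: enc_prod_def)

lemma computable_snd: "computable f \<Longrightarrow> computable (\<lambda>x. snd (f x))"
  by (erule computable_unary[OF unary_prod_decode(2)]) (simp add: enc_prod_def)

lemma computable_comp2:
  assumes "computable (\<lambda>p. f (fst p) (snd p))" "computable a" "computable b"
  shows "computable (\<lambda>x. f (a x) (b x))"
  using computable_comp[OF assms(1) computable_Pair[OF assms(2,3)]] by simp

lemma computable_comp3:
  assumes "computable (\<lambda>p. f (fst p) (fst (snd p)) (snd (snd p)))" "computable a" "computable b" "computable c"
  shows "computable (\<lambda>x. f (a x) (b x) (c x))"
  using computable_comp[OF assms(1) computable_Pair[OF assms(2) computable_Pair[OF assms(3,4)]]] by simp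

lemma computable_add_nat: "computable f \<Longrightarrow> computable g \<Longrightarrow> computable (\<lambda>x. f x + g x :: nat)"
  by (erule (1) computable_binary[OF binary_add]) simp

lemma computable_mult_nat: "computable f \<Longrightarrow> computable g \<Longrightarrow> computable (\<lambda>x. f x * g x :: nat)"
  by (erule (1) computable_binary[OF binary_mult]) simp

lemma computable_diff_nat: "computable f \<Longrightarrow> computable g \<Longrightarrow> computable (\<lambda>x. f x - g x :: nat)"
  by (erule (1) computable_binary[OF binary_diff]) simp

lemma computable_Suc: "computable f \<Longrightarrow> computable (\<lambda>x. Suc (f x))"
  using computable_add_nat[OF computable_const[of 1]] by fastforce

lemma computable_enc: "computable f \<Longrightarrow> computable (\<lambda>x. enc (f x))"
  by (erule computable_unary[OF unary_id]) simp

lemma computable_eq0: "computable f \<Longrightarrow> computable (\<lambda>x. f x = (0::nat))"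
  by (rule computable_binary[OF binary_diff computable_const[of "1::nat"]]) (auto simp: enc_bool_def)

lemma computable_not: "computable P \<Longrightarrow> computable (\<lambda>x. \<not> P x)"
  by (rule computable_binary[OF binary_diff computable_const[of "1::nat"]]) (auto simp: enc_bool_def)

lemma computable_and: "computable P \<Longrightarrow> computable Q \<Longrightarrow> computable (\<lambda>x. P x \<and> Q x)"
  by (erule (1) computable_binary[OF binary_mult]) (auto simp: enc_bool_def)

lemma computable_le_nat: "computable f \<Longrightarrow> computable g \<Longrightarrow> computable (\<lambda>x. f x \<le> (g x :: nat))"
  using computable_eq0[OF computable_diff_nat] by force

lemma computable_eq_nat:
  assumes "computable f" "computable g" shows "computable (\<lambda>x. f x = (g x :: nat))"
  using computable_and[OF computable_le_nat[OF assms] computable_le_nat[OF assms(2,1)]]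
  by (simp add: antisym_conv order_eq_iff)

text \<open>A switch: with counter 0 the program \<open>r\<close> is never started and may diverge
  on \<open>x\<close>. The sum of two switches with complementary conditions is a
  conditional.\<close>

lemma run_guard:
  assumes "n \<noteq> 0 \<Longrightarrow> run r [x] = Some v"
  shows "run (PrimRec Zero (Comp r [Proj 2])) [of_bool (n \<noteq> (0::nat)), x] = Some (if n = 0 then 0 else v)"
proof (cases "n = 0")
  case False
  then have "run (PrimRec Zero (Comp r [Proj 2])) [1, x] = Some (if (1::nat) = 0 then 0 else v)"
    by (intro run_PrimRec[where h = "\<lambda>k. if k = 0 then 0 else v"]) (simp_all add: assms)
  then show ?thesis using False by simp
qed simp

text \<open>Composition is strict, so a conditional is evaluated lazily through primitive recursion on
  the truth value of the condition.\<close>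

lemma lazy_cond:
  assumes c: "computable c"
    and r: "\<And>x. c x \<Longrightarrow> run r [enc x] = Some (enc (f x))"
    and s: "\<And>x. \<not> c x \<Longrightarrow> run s [enc x] = Some (enc (f x))"
  shows "computable f"
proof -
  obtain t where t: "\<forall>x. run t [enc x] = Some (of_bool (c x))"
    using c unfolding computable_def enc_bool_def by blast
  obtain t' where t': "\<forall>x. run t' [enc x] = Some (of_bool (\<not> c x))"
    using computable_not[OF c] unfolding computable_def enc_bool_def by blast
  obtain a where a: "\<forall>x y. run a [x, y] = Some (x + y)"
    using binary_add unfolding binary_def by blast
  let ?g = "\<lambda>r t. Comp (PrimRec Zero (Comp r [Proj 2])) [t, Proj 0]"
  have "run (Comp a [?g r t, ?g s t']) [enc x] = Some (enc (f x))" for x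
  proof -
    have "run (?g r t) [enc x] = Some (if c x then enc (f x) else 0)"
      using run_guard[where n = "of_bool (c x)" and r = r and x = "enc x" and v = "enc (f x)"] r[of x]
      by (subst run_Comp[where ys = "[of_bool (c x), enc x]"]) (simp_all add: t del: run.simps(5))
    moreover have "run (?g s t') [enc x] = Some (if c x then 0 else enc (f x))"
      using run_guard[where n = "of_bool (\<not> c x)" and r = s and x = "enc x" and v = "enc (f x)"] s[of x]
      by (subst run_Comp[where ys = "[of_bool (\<not> c x), enc x]"]) (simp_all add: t' del: run.simps(5))
    ultimately show ?thesis
      by (subst run_Comp[where ys = "[if c x then enc (f x) else 0, if c x then 0 else enc (f x)]"])
         (simp_all add: a del: run.simps)
  qed
  then show ?thesis unfolding computable_def by blast
qed

lemma computable_if: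
  assumes "computable c" "computable f" "computable g"
  shows "computable (\<lambda>x. if c x then f x else g x)"
proof -
  from assms(2,3) obtain r s where "\<forall>x. run r [enc x] = Some (enc (f x))" "\<forall>x. run s [enc x] = Some (enc (g x))"
    unfolding computable_def by blast
  then show ?thesis by (intro lazy_cond[OF assms(1), of r _ s]) auto
qed

text \<open>The result has to be total, so a witness is demanded for every \<open>x\<close> of the
  argument type. This shapes the treatment of malformed input at the end.\<close>

lemma computable_Least:
  assumes "computable (\<lambda>p. P (fst p) (snd p))" "\<And>x. \<exists>n::nat. P x n"
  shows "computable (\<lambda>x. LEAST n. P x n)"
proof -
  obtain r where r: "\<forall>p. run r [enc p] = Some (of_bool (\<not> P (fst p) (snd p)))"
    using computable_not[OF assms(1)] unfolding computable_def enc_bool_def by blast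
  obtain q where q: "\<forall>x y. run q [x, y] = Some (prod_encode (x, y))"
    using binary_prod_encode unfolding binary_def by blast
  have r': "run r [prod_encode (enc x, n)] = Some (of_bool (\<not> P x n))" for x n
    using r[rule_format, of "(x, n)"] by (simp add: enc_prod_def)
  have "run (Mu (Comp r [Comp q [Proj 1, Proj 0]])) [enc x] = Some (LEAST n. (of_bool (\<not> P x n) :: nat) = 0)" for x
    by (rule run_Mu) (use assms(2) in \<open>simp_all add: q r'\<close>)
  then have "run (Mu (Comp r [Comp q [Proj 1, Proj 0]])) [enc x] = Some (enc (LEAST n. P x n))" for x
    by (simp del: run.simps)
  then show ?thesis unfolding computable_def by blast
qed

lemma computable_funpow:
  fixes f :: "'a::enc \<Rightarrow> 'b::enc \<Rightarrow> 'b"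
  assumes f: "computable (\<lambda>p. f (fst p) (snd p))" and n: "computable n" and s: "computable s"
  shows "computable (\<lambda>x. ((f x) ^^ n x) (s x))"
proof -
  obtain r where r: "\<forall>p. run r [enc p] = Some (enc (f (fst p) (snd p)))"
    using f unfolding computable_def by blast
  have r': "run r [prod_encode (enc x, enc y)] = Some (enc (f x y))" for x y
    using r[rule_format, of "(x, y)"] by (simp add: enc_prod_def)
  obtain rn where rn: "\<forall>x. run rn [enc x] = Some (n x)" using n unfolding computable_def by auto
  obtain rs where rs: "\<forall>x. run rs [enc x] = Some (enc (s x))" using s unfolding computable_def by auto
  obtain q where q: "\<forall>x y. run q [x, y] = Some (prod_encode (x, y))"
    using binary_prod_encode unfolding binary_def by blast
  let ?R = "PrimRec rs (Comp r [Comp q [Proj 2, Proj 1]])"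
  have "run ?R [k, enc x] = Some (enc (((f x) ^^ k) (s x)))" for k x
    by (rule run_PrimRec[where h = "\<lambda>k. enc (((f x) ^^ k) (s x))"]) (simp_all add: rs q r')
  then have "run (Comp ?R [rn, Proj 0]) [enc x] = Some (enc (((f x) ^^ n x) (s x)))" for x
    by (subst run_Comp[where ys = "[n x, enc x]"]) (simp_all add: rn del: run.simps(5))
  then show ?thesis unfolding computable_def by blast
qed

section \<open>Encoded lists\<close>

lemma computable_null: "computable f \<Longrightarrow> computable (\<lambda>x. f x = [])"
proof -
  assume "computable f"
  then have "computable (\<lambda>x. enc (f x) = 0)" by (intro computable_eq0 computable_enc)
  moreover have "enc xs = 0 \<longleftrightarrow> xs = []" for xs :: "'b list" by (cases xs) (simp_all add: enc_list_def)
  ultimately show ?thesis by simp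
qed

lemma computable_Cons: "computable f \<Longrightarrow> computable g \<Longrightarrow> computable (\<lambda>x. f x # g x)"
  by (erule (1) computable_binary[OF binary_comp2[OF binary_add binary_prod_encode binary_comp1[OF unary_const[of 1] binary_fst]]])
     (simp add: enc_list_def)

lemma computable_tl: "computable f \<Longrightarrow> computable (\<lambda>x. tl (f x))"
proof (rule computable_unary[where h = "\<lambda>c. snd (prod_decode (c - 1))"])
  show "unary (\<lambda>c. snd (prod_decode (c - 1)))"
    by (rule unary_comp[OF unary_prod_decode(2) unary_pred])
  \<comment> \<open>For the empty list the code 0 survives the truncated predecessor, and unpairing
    0 gives 0 again, in accordance with \<open>tl [] = []\<close>.\<close>
  have "prod_decode 0 = (0, 0)" using prod_encode_inverse[of "(0, 0)"] by (simp add: prod_encode_def)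
  then show "enc (tl (f x)) = snd (prod_decode (enc (f x) - 1))" for x
    by (cases "f x") (simp_all add: enc_list_def)
qed

text \<open>On the empty list the number passed to the Cons branch may be no code at all, and there
  \<open>rh\<close> promises nothing, not even termination. Hence the lazy conditional.\<close>

lemma computable_case_list:
  assumes xs: "computable xs" and d: "computable d"
    and h: "computable (\<lambda>p. h (fst p) (fst (snd p)) (snd (snd p)))"
  shows "computable (\<lambda>x. case xs x of [] \<Rightarrow> d x | y # ys \<Rightarrow> h x y ys)"
proof -
  obtain rd where rd: "\<forall>x. run rd [enc x] = Some (enc (d x))" using d unfolding computable_def by blast
  obtain rx where rx: "\<forall>x. run rx [enc x] = Some (enc (xs x))" using xs unfolding computable_def by blast
  obtain rh where rh: "\<forall>p. run rh [enc p] = Some (enc (h (fst p) (fst (snd p)) (snd (snd p))))"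
    using h unfolding computable_def by blast
  obtain q where q: "\<forall>x y. run q [x, y] = Some (prod_encode (x, y))"
    using binary_prod_encode unfolding binary_def by blast
  obtain m where m: "\<forall>x. run m [x] = Some (x - 1)" using unary_pred unfolding unary_def by blast
  show ?thesis
  proof (rule lazy_cond[OF computable_null[OF xs], where r = rd and s = "Comp rh [Comp q [Proj 0, Comp m [rx]]]"])
    fix x assume "xs x \<noteq> []"
    then obtain y ys where "xs x = y # ys" by (cases "xs x") auto
    then show "run (Comp rh [Comp q [Proj 0, Comp m [rx]]]) [enc x] =
        Some (enc (case xs x of [] \<Rightarrow> d x | y # ys \<Rightarrow> h x y ys))"
      using rh[rule_format, of "(x, y, ys)"] by (simp add: rx m q enc_prod_def enc_list_def)
  qed (simp add: rd)
qed

lemma length_le_enc: "length xs \<le> enc (xs :: 'a::enc list)"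
proof (induction xs)
  case (Cons x xs)
  then show ?case using le_prod_encode_2[of "enc xs" "enc x"] by (simp add: enc_list_def)
qed simp

text \<open>The loop runs \<open>enc (xs x)\<close> times, at least the length by
  \<open>length_le_enc\<close>; once the list is exhausted the remaining steps are idle. The length
  function itself is later obtained as a fold.\<close>

lemma computable_fold:
  assumes f: "computable (\<lambda>p. f (fst p) (fst (snd p)) (snd (snd p)))"
    and xs: "computable xs" and s: "computable s"
  shows "computable (\<lambda>x. fold (f x) (xs x) (s x))"
proof -
  define step where "step x q = (case fst q of [] \<Rightarrow> q | y # ys \<Rightarrow> (ys, f x y (snd q)))" for x q
  have pow: "length l \<le> n \<Longrightarrow> snd ((step x ^^ n) (l, a)) = fold (f x) l a" for l n a x
  proof (induction n arbitrary: l a)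
    case (Suc n)
    have "(step x ^^ n) ([], a) = ([], a)" for n a by (induction n) (simp_all add: step_def)
    with Suc show ?case
      by (cases l) (simp_all add: funpow_swap1[symmetric] step_def del: funpow.simps(2) add: funpow_Suc_right)
  qed simp
  have f': "computable (\<lambda>p. f (fst (fst p)) (fst (snd p)) (snd (snd (fst p))))"
    by (intro computable_comp3[OF f] computable_id computable_fst computable_snd)
  have "computable (\<lambda>x. snd ((step x ^^ enc (xs x)) (xs x, s x)))"
    unfolding step_def
    by (intro f' computable_snd computable_funpow computable_case_list computable_Pair computable_enc
       computable_fst computable_id xs s)
  then show ?thesis by (simp add: pow length_le_enc)
qed


lemma computable_rev: "computable xs \<Longrightarrow> computable (\<lambda>x. rev (xs x))"
  unfolding rev_conv_fold
  by (intro computable_fold computable_Cons computable_fst computable_snd computable_id computable_const)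

lemma computable_append: "computable xs \<Longrightarrow> computable ys \<Longrightarrow> computable (\<lambda>x. xs x @ ys x)"
proof -
  assume "computable xs" "computable ys"
  then have "computable (\<lambda>x. fold (\<lambda>y ys. y # ys) (rev (xs x)) (ys x))"
    by (intro computable_fold computable_rev computable_Cons computable_fst computable_snd computable_id)
  moreover have "fold (\<lambda>y ys. y # ys) (rev as) bs = as @ bs" for as bs :: "'b list"
    by (induction as arbitrary: bs) simp_all
  ultimately show ?thesis by simp
qed

lemma computable_concat:
  assumes "computable xss" shows "computable (\<lambda>x. concat (xss x))"
proof -
  have "computable (\<lambda>x. fold (\<lambda>ys zs. zs @ ys) (xss x) [])"
    by (intro assms computable_fold computable_append computable_fst computable_snd computable_id computable_const)
  moreover have "fold (\<lambda>ys zs. zs @ ys) yss as = as @ concat yss" for as :: "'b list" and yss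
    by (induction yss arbitrary: as) simp_all
  ultimately show ?thesis by simp
qed

lemma computable_map:
  assumes f: "computable (\<lambda>p. f (fst p) (snd p))" and "computable xs"
  shows "computable (\<lambda>x. map (f x) (xs x))"
proof -
  have "computable (\<lambda>x. rev (fold (\<lambda>y ys. f x y # ys) (xs x) []))"
    by (intro assms computable_comp2[OF f] computable_rev computable_fold computable_Cons
        computable_fst computable_snd computable_id computable_const)
  moreover have "fold (\<lambda>y ys. f x y # ys) zs as = rev (map (f x) zs) @ as" for x zs as
    by (induction zs arbitrary: as) simp_all
  ultimately show ?thesis by simp
qed

lemma computable_filter:
  assumes P: "computable (\<lambda>p. P (fst p) (snd p))" and "computable xs"
  shows "computable (\<lambda>x. filter (P x) (xs x))"
proof -
  have "computable (\<lambda>x. concat (map (\<lambda>y. if P x y then [y] else []) (xs x)))"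
    by (intro assms computable_comp2[OF P] computable_concat computable_map computable_if computable_Cons
        computable_fst computable_snd computable_id computable_const)
  moreover have "concat (map (\<lambda>y. if P x y then [y] else []) zs) = filter (P x) zs" for x zs
    by (induction zs) simp_all
  ultimately show ?thesis by simp
qed

lemma computable_list_all:
  assumes P: "computable (\<lambda>p. P (fst p) (snd p))" and "computable xs"
  shows "computable (\<lambda>x. list_all (P x) (xs x))"
proof -
  have "computable (\<lambda>x. filter (\<lambda>y. \<not> P x y) (xs x) = [])"
    by (intro assms computable_null computable_filter computable_not)
  then show ?thesis by (simp add: filter_empty_conv list_all_iff)
qed

lemma computable_length: "computable xs \<Longrightarrow> computable (\<lambda>x. length (xs x))"
proof -
  assume "computable xs"
  then have "computable (\<lambda>x. fold (\<lambda>_ n. Suc n) (xs x) 0)"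
    by (intro computable_fold computable_Suc computable_snd computable_id computable_const)
  moreover have "fold (\<lambda>_ n. Suc n) as n = n + length as" for as :: "'b list" and n
    by (induction as arbitrary: n) simp_all
  ultimately show ?thesis by simp
qed

lemma computable_upt0:
  assumes "computable n" shows "computable (\<lambda>x. [0..<n x])"
proof -
  \<comment> \<open>The iterated function does not see how often it has run; the length of the list
    built so far serves as the counter.\<close>
  have "computable (\<lambda>x. ((\<lambda>l. l @ [length l]) ^^ n x) [])"
    by (intro assms computable_funpow computable_append computable_Cons computable_length computable_snd
        computable_id computable_const)
  moreover have "((\<lambda>l. l @ [length l]) ^^ n) [] = [0..<n]" for n
    by (induction n) simp_all
  ultimately show ?thesis by simp
qed

lemma computable_nth_default:
  assumes "computable d" "computable xs" "computable n"
  shows "computable (\<lambda>x. nth_default (d x) (xs x) (n x))"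
proof -
  have "computable (\<lambda>x. case (tl ^^ n x) (xs x) of [] \<Rightarrow> d x | y # ys \<Rightarrow> y)"
    by (intro assms computable_case_list computable_funpow computable_tl computable_fst computable_snd computable_id)
  moreover have "(case (tl ^^ k) as of [] \<Rightarrow> a | y # ys \<Rightarrow> y) = nth_default a as k" for as k and a :: 'b
  proof (induction k arbitrary: as)
    case 0
    show ?case by (cases as) simp_all
  next
    case (Suc k)
    have "(tl ^^ k) [] = []" for k by (induction k) simp_all
    with Suc show ?case by (cases as) (simp_all add: funpow_Suc_right del: funpow.simps(2))
  qed
  ultimately show ?thesis by simp
qed

section \<open>Encoded integers\<close>

lemma int_encode_nonneg: "int_encode (int n) = 2 * n"
  by (simp add: int_encode_def sum_encode_def)

lemma computable_int: "computable f \<Longrightarrow> computable (\<lambda>x. int (f x))"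
  by (erule computable_binary[OF binary_mult computable_const[of "2::nat"]]) (simp add: enc_int_def int_encode_nonneg)

text \<open>\<open>int_encode\<close> maps n to 2n and -m to 2m - 1 for m > 0, so a difference of
  naturals has an explicit code. Sums, negatives and products of integers are computed on the parts
  \<open>nat i\<close> and \<open>nat (- i)\<close> and return through this rule.\<close>

lemma computable_diff_int:
  assumes "computable f" "computable g" shows "computable (\<lambda>x. int (f x) - int (g x))"
proof (rule computable_unary[OF unary_id])
  show "computable (\<lambda>x. if g x \<le> f x then 2 * (f x - g x) else 2 * (g x - f x) - 1)"
    by (intro assms computable_if computable_le_nat computable_mult_nat computable_diff_nat computable_const)
  show "enc (int (f x) - int (g x)) = enc (if g x \<le> f x then 2 * (f x - g x) else 2 * (g x - f x) - 1)" for x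
    by (auto simp: enc_int_def int_encode_def sum_encode_def nat_diff_distrib')
qed

lemma computable_div2: "computable f \<Longrightarrow> computable (\<lambda>x. f x div 2 :: nat)"
  by (erule computable_unary[OF unary_div2]) simp

lemma computable_nat:
  assumes "computable f" shows "computable (\<lambda>x. nat (f x))" "computable (\<lambda>x. nat (- f x))"
proof -
  let ?c = "\<lambda>x. enc (f x)"
  have "computable (\<lambda>x. if ?c x = 2 * (?c x div 2) then ?c x div 2 else 0)"
    by (intro assms computable_if computable_eq_nat computable_mult_nat computable_div2 computable_const computable_enc)
  moreover have "nat (f x) = (if ?c x = 2 * (?c x div 2) then ?c x div 2 else 0)" for x
    by (auto simp: enc_int_def int_encode_def sum_encode_def)
  ultimately show "computable (\<lambda>x. nat (f x))" by simp
  have "computable (\<lambda>x. if ?c x = 2 * (?c x div 2) then 0 else Suc (?c x div 2))"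
    by (intro assms computable_if computable_eq_nat computable_mult_nat computable_div2 computable_const computable_enc computable_Suc)
  moreover have "nat (- f x) = (if ?c x = 2 * (?c x div 2) then 0 else Suc (?c x div 2))" for x
    by (auto simp: enc_int_def int_encode_def sum_encode_def)
  ultimately show "computable (\<lambda>x. nat (- f x))" by simp
qed

lemma computable_add_int:
  assumes "computable f" "computable g" shows "computable (\<lambda>x. f x + g x :: int)"
proof -
  have "computable (\<lambda>x. int (nat (f x) + nat (g x)) - int (nat (- f x) + nat (- g x)))"
    by (intro assms computable_diff_int computable_add_nat computable_nat)
  moreover have "f x + g x = int (nat (f x) + nat (g x)) - int (nat (- f x) + nat (- g x))" for x
    by simp
  ultimately show ?thesis by presburger
qed

lemma computable_uminus_int:
  assumes "computable f" shows "computable (\<lambda>x. - f x :: int)"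
proof -
  have "computable (\<lambda>x. int (nat (- f x)) - int (nat (f x)))"
    by (intro assms computable_diff_int computable_nat)
  moreover have "int (nat (- f x)) - int (nat (f x)) = - f x" for x
    by simp
  ultimately show ?thesis by (simp only:)
qed

lemma computable_mult_int:
  assumes "computable f" "computable g" shows "computable (\<lambda>x. f x * g x :: int)"
proof -
  have "computable (\<lambda>x. int (nat (f x) * nat (g x) + nat (- f x) * nat (- g x))
      - int (nat (f x) * nat (- g x) + nat (- f x) * nat (g x)))"
    by (intro assms computable_diff_int computable_add_nat computable_mult_nat computable_nat)
  moreover have "f x * g x = int (nat (f x) * nat (g x) + nat (- f x) * nat (- g x))
      - int (nat (f x) * nat (- g x) + nat (- f x) * nat (g x))" for x
  proof -
    have "f x * g x = (int (nat (f x)) - int (nat (- f x))) * (int (nat (g x)) - int (nat (- g x)))"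
      by simp
    then show ?thesis by (simp only: of_nat_add of_nat_mult) (simp only: algebra_simps)
  qed
  ultimately show ?thesis by presburger
qed

lemma computable_eq_int:
  assumes "computable f" "computable g" shows "computable (\<lambda>x. f x = (g x :: int))"
proof -
  have "computable (\<lambda>x. enc (f x) = enc (g x))"
    by (intro assms computable_eq_nat computable_enc)
  then show ?thesis by (simp add: enc_int_def int_encode_eq)
qed

lemma computable_less_int:
  assumes "computable f" "computable g" shows "computable (\<lambda>x. f x < (g x :: int))"
proof -
  have "computable (\<lambda>x. \<not> nat (g x + - f x) = 0)"
    by (intro assms computable_not computable_eq0 computable_nat computable_add_int computable_uminus_int)
  moreover have "(nat (g x + - f x) = 0) = (\<not> f x < g x)" for x by auto
  ultimately show ?thesis by simp
qed

lemma computable_abs_int: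
  assumes "computable f" shows "computable (\<lambda>x. \<bar>f x :: int\<bar>)"
proof -
  have "computable (\<lambda>x. int (nat (f x)) + int (nat (- f x)))"
    by (intro assms computable_add_int computable_int computable_nat)
  moreover have "int (nat (f x)) + int (nat (- f x)) = \<bar>f x\<bar>" for x by auto
  ultimately show ?thesis by simp
qed

lemma computable_sum_list_int: 
  assumes "computable xs" shows "computable (\<lambda>x. sum_list (xs x) :: int)"
proof -
  have "computable (\<lambda>x. fold (\<lambda>i s. s + i) (xs x) 0)"
    by (intro assms computable_fold computable_add_int computable_fst computable_snd computable_id computable_const)
  moreover have "fold (\<lambda>i s. s + i) as n = n + sum_list as" for as :: "int list" and n
    by (induction as arbitrary: n) simp_all
  ultimately show ?thesis by simp
qed

text \<open>Applied by \<open>intro\<close>, these rules follow the syntax of a definition. The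
  definitions of the algorithm are phrased accordingly: integer subtraction is written
  \<open>a + - b\<close>, an existential test is a negated \<open>list_all\<close>, and ranges have
  the form \<open>[0..<n]\<close>.\<close>

lemmas computable_intros = computable_id computable_const
  computable_Pair computable_fst computable_snd computable_Cons computable_tl
  computable_Suc computable_add_nat computable_mult_nat computable_diff_nat
  computable_eq_nat computable_le_nat computable_null computable_not computable_and computable_if
  computable_append computable_concat computable_map computable_filter computable_list_all computable_length
  computable_upt0 computable_nth_default computable_funpow
  computable_int computable_nat(1) computable_add_int computable_uminus_int computable_mult_int
  computable_eq_int computable_less_int computable_abs_int computable_sum_list_int computable_fold

section \<open>Nonnegative combinations of integer vectors\<close>

text \<open>Each step adds one generator with coefficient 1, which turns closure properties into
  inductions; explicit coefficients come from \<open>comb\<close>.\<close>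

inductive_set nspan :: "(nat \<Rightarrow> int) set \<Rightarrow> (nat \<Rightarrow> int) set" for S where
  zero: "(\<lambda>i. 0) \<in> nspan S"
| add: "c \<in> S \<Longrightarrow> v \<in> nspan S \<Longrightarrow> (\<lambda>i. c i + v i) \<in> nspan S"

lemma nspan_base: "c \<in> S \<Longrightarrow> c \<in> nspan S"
  using nspan.add[OF _ nspan.zero, of c S] by simp

lemma nspan_plus:
  assumes "u \<in> nspan S" "v \<in> nspan S" shows "(\<lambda>i. u i + v i) \<in> nspan S"
  using assms(1)
proof induction
  case (add c w)
  then show ?case using nspan.add[of c S "\<lambda>i. w i + v i"] by (simp add: add.assoc)
qed (simp add: assms(2))

lemma nspan_scale:
  assumes "v \<in> nspan S" "0 \<le> n" shows "(\<lambda>i. n * v i) \<in> nspan S"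
  using assms(2)
proof (induction n rule: int_ge_induct)
  case base
  show ?case using nspan.zero by simp
next
  case (step n)
  show ?case using nspan_plus[OF assms(1) step(2)] by (simp add: algebra_simps)
qed

lemma nspan_combine:
  assumes "c \<in> S" "c' \<in> S" "0 \<le> a" "0 \<le> b" shows "(\<lambda>i. a * c i + b * c' i) \<in> nspan S"
  using assms by (intro nspan_plus nspan_scale nspan_base)

lemma nspan_least: "S \<subseteq> nspan T \<Longrightarrow> v \<in> nspan S \<Longrightarrow> v \<in> nspan T"
  by (rotate_tac, induction rule: nspan.induct) (auto intro: nspan.zero nspan_plus)

lemma nspan_mono: "S \<subseteq> T \<Longrightarrow> v \<in> nspan S \<Longrightarrow> v \<in> nspan T"
  by (rule nspan_least) (auto intro: nspan_base)

lemma nspan_zero_coord: "v \<in> nspan S \<Longrightarrow> (\<And>c. c \<in> S \<Longrightarrow> c i = 0) \<Longrightarrow> v i = 0"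
  by (induction rule: nspan.induct) auto

text \<open>Turns differences into plain membership. With \<open>T = S\<close> it expresses the
  lattice; with \<open>T\<close> the generators of a monoid it expresses that a shift of this monoid
  meets the semigroup.\<close>

lemma nspan_Un_uminus:
  "u \<in> nspan (S \<union> (\<lambda>c i. - c i) ` T) \<longleftrightarrow> (\<exists>a \<in> nspan S. \<exists>b \<in> nspan T. u = (\<lambda>i. a i - b i))"
    (is "?L \<longleftrightarrow> ?R")
proof
  show "?L \<Longrightarrow> ?R"
  proof (induction rule: nspan.induct)
    case zero
    show ?case using nspan.zero by (intro bexI[of _ "\<lambda>i. 0"]) auto
  next
    case (add c v)
    then obtain a b where ab: "a \<in> nspan S" "b \<in> nspan T" "v = (\<lambda>i. a i - b i)" by blast
    from add(1) show ?case
    proof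
      assume "c \<in> S"
      then have "(\<lambda>i. c i + a i) \<in> nspan S" using ab by (intro nspan.add)
      moreover have "(\<lambda>i. c i + v i) = (\<lambda>i. (c i + a i) - b i)" by (simp add: ab algebra_simps)
      ultimately show ?case using ab(2) by (intro bexI[of _ "\<lambda>i. c i + a i"] bexI[of _ b])
    next
      assume "c \<in> (\<lambda>c i. - c i) ` T"
      then obtain t where t: "t \<in> T" "c = (\<lambda>i. - t i)" by blast
      then have "(\<lambda>i. t i + b i) \<in> nspan T" using ab by (intro nspan.add)
      moreover have "(\<lambda>i. c i + v i) = (\<lambda>i. a i - (t i + b i))" by (simp add: ab t algebra_simps)
      ultimately show ?case using ab(1) by (intro bexI[of _ a] bexI[of _ "\<lambda>i. t i + b i"])
    qed
  qed
  assume ?R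
  then obtain a b where ab: "a \<in> nspan S" "b \<in> nspan T" "u = (\<lambda>i. a i - b i)" by blast
  have "(\<lambda>i. - b i) \<in> nspan ((\<lambda>c i. - c i) ` T)"
    using ab(2)
  proof induction
    case zero
    show ?case using nspan.zero by simp
  next
    case (add c v)
    then show ?case using nspan.add[of "\<lambda>i. - c i" "(\<lambda>c i. - c i) ` T" "\<lambda>i. - v i"] by auto
  qed
  then have "(\<lambda>i. - b i) \<in> nspan (S \<union> (\<lambda>c i. - c i) ` T)" "a \<in> nspan (S \<union> (\<lambda>c i. - c i) ` T)"
    using ab(1) by (auto intro: nspan_mono[rotated])
  then show ?L using nspan_plus[of a _ "\<lambda>i. - b i"] ab(3) by simp
qed

text \<open>Isolates the multiplicity of one generator. It serves to speak about multiples of z by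
  inserting -z, and to count the extra column in \<open>rspan_int_multiple\<close>.\<close>

lemma nspan_insert:
  "u \<in> nspan (insert a S) \<longleftrightarrow> (\<exists>k\<ge>0. \<exists>q \<in> nspan S. u = (\<lambda>i. k * a i + q i))" (is "?L \<longleftrightarrow> ?R")
proof
  show "?L \<Longrightarrow> ?R"
  proof (induction rule: nspan.induct)
    case zero
    show ?case using nspan.zero by (intro exI[of _ 0] conjI bexI[of _ "\<lambda>i. 0"]) auto
  next
    case (add c v)
    then obtain k q where kq: "k \<ge> 0" "q \<in> nspan S" "v = (\<lambda>i. k * a i + q i)" by blast
    show ?case
    proof (cases "c = a")
      case True
      then have "(\<lambda>i. c i + v i) = (\<lambda>i. (k + 1) * a i + q i)" by (simp add: kq algebra_simps)
      then show ?thesis using kq by (intro exI[of _ "k + 1"] conjI bexI[of _ q]) auto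
    next
      case False
      then have "(\<lambda>i. c i + q i) \<in> nspan S" using kq add(1) by (intro nspan.add) auto
      moreover have "(\<lambda>i. c i + v i) = (\<lambda>i. k * a i + (c i + q i))" by (simp add: kq algebra_simps)
      ultimately show ?thesis using kq(1) by (intro exI[of _ k] conjI bexI[of _ "\<lambda>i. c i + q i"])
    qed
  qed
  assume ?R
  then obtain k q where kq: "k \<ge> 0" "q \<in> nspan S" "u = (\<lambda>i. k * a i + q i)" by blast
  show ?L unfolding kq(3)
    using kq nspan_mono[of S "insert a S" q] by (intro nspan_plus nspan_scale) (auto intro: nspan_base)
qed

definition comb :: "(nat \<Rightarrow> int) \<Rightarrow> (nat \<Rightarrow> int) list \<Rightarrow> nat \<Rightarrow> int" where
  "comb f cs = (\<lambda>i. \<Sum>j<length cs. f j * (cs ! j) i)"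

lemma comb_plus: "comb (\<lambda>j. f j + g j) cs i = comb f cs i + comb g cs i"
  by (simp add: comb_def algebra_simps sum.distrib)

lemma comb_single: "j < length cs \<Longrightarrow> comb (\<lambda>k. if k = j then a else 0) cs i = a * (cs ! j) i"
proof -
  assume "j < length cs"
  then have "(\<Sum>k<length cs. (if k = j then a else 0) * (cs ! k) i) = (\<Sum>k<length cs. if k = j then a * (cs ! j) i else 0)"
    by (intro sum.cong) auto
  with \<open>j < length cs\<close> show ?thesis by (simp add: comb_def)
qed

lemma comb_in_nspan:
  assumes "\<And>j. j < length cs \<Longrightarrow> 0 \<le> f j" "\<And>j. j < length cs \<Longrightarrow> f j \<noteq> 0 \<Longrightarrow> cs ! j \<in> S"
  shows "comb f cs \<in> nspan S"
proof -
  have "(\<lambda>i. \<Sum>j<m. f j * (cs ! j) i) \<in> nspan S" if "m \<le> length cs" for m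
    using that
  proof (induction m)
    case 0
    show ?case using nspan.zero by simp
  next
    case (Suc m)
    have "(\<lambda>i. f m * (cs ! m) i) \<in> nspan S"
    proof (cases "f m = 0")
      case True
      then show ?thesis using nspan.zero by simp
    next
      case False
      with Suc.prems assms show ?thesis by (intro nspan_scale nspan_base) auto
    qed
    with Suc show ?case
      using nspan_plus[of "\<lambda>i. \<Sum>j<m. f j * (cs ! j) i" S "\<lambda>i. f m * (cs ! m) i"] by simp
  qed
  then show ?thesis by (simp add: comb_def)
qed

lemma comb_in_nspan_set: "(\<And>j. j < length cs \<Longrightarrow> 0 \<le> f j) \<Longrightarrow> comb f cs \<in> nspan (set cs)"
  by (rule comb_in_nspan) simp_all

text \<open>Columns may repeat, so the support is controlled by positions and not by vectors.
  \<open>ex_separated\<close> relies on the coefficients outside \<open>J\<close> being 0.\<close>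

lemma nspan_combE:
  assumes "v \<in> nspan ((!) cs ` J)" "J \<subseteq> {..<length cs}"
  obtains f where "\<And>j. 0 \<le> f j" "\<And>j. j \<notin> J \<Longrightarrow> f j = 0" "v = comb f cs"
proof -
  have "\<exists>f. (\<forall>j. 0 \<le> f j) \<and> (\<forall>j. j \<notin> J \<longrightarrow> f j = 0) \<and> v = comb f cs"
    using assms(1)
  proof induction
    case zero
    show ?case by (rule exI[of _ "\<lambda>_. 0"]) (simp add: comb_def)
  next
    case (add c v)
    then obtain f where f: "\<forall>j. 0 \<le> f j" "\<forall>j. j \<notin> J \<longrightarrow> f j = 0" "v = comb f cs" by blast
    obtain j where j: "j \<in> J" "j < length cs" "cs ! j = c" using add(1) assms(2) by blast
    have "(\<lambda>i. c i + v i) = comb (\<lambda>k. (if k = j then 1 else 0) + f k) cs"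
      by (rule ext) (simp add: comb_plus comb_single[OF j(2)] f(3) j(3))
    moreover have "\<forall>k. k \<notin> J \<longrightarrow> (if k = j then 1 else 0) + f k = 0"
      using f(2) j(1) by auto
    ultimately show ?case using f(1) by (intro exI[of _ "\<lambda>k. (if k = j then 1 else 0) + f k"]) auto
  qed
  then show ?thesis using that by blast
qed

lemma set_conv_image_nth: "set cs = (!) cs ` {..<length cs}"
  by (auto simp: in_set_conv_nth)

lemma nspan_set_combE:
  assumes "v \<in> nspan (set cs)"
  obtains f where "\<And>j. 0 \<le> f j" "v = comb f cs"
proof -
  from assms have "v \<in> nspan ((!) cs ` {..<length cs})" by (simp only: set_conv_image_nth)
  then obtain f where "\<And>j. 0 \<le> f j" "v = comb f cs" by (rule nspan_combE) auto
  then show thesis by (rule that)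
qed

lemma comb_diff: "comb (\<lambda>j. f j - g j) cs i = comb f cs i - comb g cs i"
  by (simp add: comb_def algebra_simps sum_subtractf)

subsection \<open>Elimination of a coordinate\<close>

text \<open>The Fourier-Motzkin step, with cross-multiplied coefficients for columns of opposite
  sign. Over the integers these vectors need not generate every combination of S that vanishes at i:
  for entries 2 and -2 the plain sum of the two columns may be missed. The bounded remainder in
  \<open>reduce_coeffs\<close> makes up for this.\<close>

definition elim_coord :: "nat \<Rightarrow> (nat \<Rightarrow> int) set \<Rightarrow> (nat \<Rightarrow> int) set" where
  "elim_coord i S = {c \<in> S. c i = 0} \<union>
     {\<lambda>k. - c' i * c k + c i * c' k | c c'. c \<in> S \<and> c' \<in> S \<and> 0 < c i \<and> c' i < 0}"

lemma elim_coord_nspan: "elim_coord i S \<subseteq> nspan S"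
proof
  fix v assume "v \<in> elim_coord i S"
  then consider "v \<in> S" | c c' where "v = (\<lambda>k. - c' i * c k + c i * c' k)" "c \<in> S" "c' \<in> S" "0 < c i" "c' i < 0"
    unfolding elim_coord_def by blast
  then show "v \<in> nspan S"
  proof cases
    case 2
    then show ?thesis using nspan_combine[of c S c' "- c' i" "c i"] by simp
  qed (rule nspan_base)
qed

lemma elim_coord_zero: "c \<in> elim_coord i S \<Longrightarrow> c i = 0"
  by (auto simp: elim_coord_def)

text \<open>If positive entries have coefficients at most \<open>s\<close>, the positive part of the
  sum is at most \<open>s * s\<close>. Up to the absolute value of the total, this also bounds the
  negative part, and there each coefficient is at most its term because a nonzero integer has
  absolute value at least 1. The last \<open>s\<close> covers positive entries.\<close>

lemma coeff_bound:
  fixes a f :: "nat \<Rightarrow> int" and m :: nat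
  defines "s \<equiv> \<Sum>j<m. \<bar>a j\<bar>"
  assumes f: "\<And>j. 0 \<le> f j" and pos: "\<And>j. j < m \<Longrightarrow> 0 < a j \<Longrightarrow> f j \<le> s"
    and k: "k < m" "a k \<noteq> 0"
  shows "f k \<le> \<bar>\<Sum>j<m. f j * a j\<bar> + s * s + s"
proof (cases "0 < a k")
  case True
  have "0 \<le> s" unfolding s_def by (simp add: sum_nonneg)
  then have "0 \<le> s * s" by simp
  then show ?thesis using pos[OF k(1) True] by linarith
next
  case False
  let ?P = "{j \<in> {..<m}. 0 < a j}" and ?N = "{j \<in> {..<m}. \<not> 0 < a j}"
  have s0: "0 \<le> s" unfolding s_def by (simp add: sum_nonneg)
  have split: "(\<Sum>j<m. f j * a j) = (\<Sum>j\<in>?P. f j * a j) + (\<Sum>j\<in>?N. f j * a j)"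
    by (subst sum.union_disjoint[symmetric]) (auto intro: sum.cong)
  have "(\<Sum>j\<in>?P. f j * a j) \<le> (\<Sum>j\<in>?P. s * \<bar>a j\<bar>)"
    using pos by (intro sum_mono) (auto intro: mult_right_mono)
  also have "\<dots> \<le> (\<Sum>j<m. s * \<bar>a j\<bar>)"
    using s0 by (intro sum_mono2) auto
  also have "\<dots> = s * s" by (simp add: s_def sum_distrib_left)
  finally have P: "(\<Sum>j\<in>?P. f j * a j) \<le> s * s" .
  have "f k \<le> f k * - a k"
    using f[of k] False k(2) mult_left_mono[of 1 "- a k" "f k"] by simp
  also have "\<dots> \<le> (\<Sum>j\<in>?N. f j * - a j)"
  proof (rule member_le_sum[of k ?N "\<lambda>j. f j * - a j"])
    show "k \<in> ?N" using k False by simp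
    show "0 \<le> f j * - a j" if "j \<in> ?N - {k}" for j
      using that f[of j] by (auto intro!: mult_nonneg_nonneg simp del: mult_minus_right)
  qed simp
  also have "\<dots> = - (\<Sum>j\<in>?N. f j * a j)" by (simp add: sum_negf)
  also have "\<dots> \<le> \<bar>\<Sum>j<m. f j * a j\<bar> + s * s" using split P by linarith
  finally show ?thesis using s0 by linarith
qed

text \<open>Descent on the sum of the coefficients: as long as a column vanishing at i is in use, or
  a cancelling pair can be taken out, subtract it. Coordinate i, and with it the condition on
  \<open>B\<close>, stays the same. When nothing can be taken out, one of the two sign classes has
  all its coefficients at most \<open>s\<close>, and \<open>coeff_bound\<close> controls the
  rest.\<close>

lemma reduce_coeffs:
  fixes cs :: "(nat \<Rightarrow> int) list" and i :: nat
  defines "s \<equiv> \<Sum>j<length cs. \<bar>(cs ! j) i\<bar>"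
  assumes "\<And>j. 0 \<le> f j" "\<bar>comb f cs i\<bar> + s * s + s \<le> B"
  shows "\<exists>g. (\<forall>j. 0 \<le> g j) \<and> (\<forall>j<length cs. g j \<le> B) \<and>
    (\<lambda>k. comb f cs k - comb g cs k) \<in> nspan (elim_coord i (set cs))"
  using assms(2,3)
proof (induction "nat (\<Sum>j<length cs. f j)" arbitrary: f rule: less_induct)
  case less
  let ?m = "length cs" and ?a = "\<lambda>j. (cs ! j) i"
  note f = less.prems(1)
  have IH: ?case
    if h: "\<And>j. 0 \<le> h j" "\<And>j. h j \<le> f j" and j: "j < ?m" "h j < f j"
      and e: "(\<lambda>k. comb (\<lambda>j. f j - h j) cs k) \<in> elim_coord i (set cs)" for h j
  proof -
    have "(\<Sum>j<?m. h j) < (\<Sum>j<?m. f j)" using h j by (intro sum_strict_mono_ex1) auto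
    moreover have "0 \<le> (\<Sum>j<?m. h j)" using h by (simp add: sum_nonneg)
    moreover have "comb f cs i = comb h cs i"
      using elim_coord_zero[OF e] by (simp add: comb_diff)
    ultimately obtain g where g: "\<forall>j. 0 \<le> g j" "\<forall>j<?m. g j \<le> B"
      "(\<lambda>k. comb h cs k - comb g cs k) \<in> nspan (elim_coord i (set cs))"
      using less.hyps[of h] h(1) less.prems(2) by auto
    have "(\<lambda>k. comb (\<lambda>j. f j - h j) cs k + (comb h cs k - comb g cs k)) \<in> nspan (elim_coord i (set cs))"
      by (rule nspan.add[OF e g(3)])
    then have "(\<lambda>k. comb f cs k - comb g cs k) \<in> nspan (elim_coord i (set cs))"
      by (simp add: comb_diff)
    with g show ?thesis by blast
  qed
  consider (z) j where "j < ?m" "?a j = 0" "0 < f j"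
    | (pn) j k where "j < ?m" "k < ?m" "0 < ?a j" "?a k < 0" "- ?a k \<le> f j" "?a j \<le> f k"
    | (b) "\<And>j. j < ?m \<Longrightarrow> ?a j = 0 \<Longrightarrow> f j = 0"
       "\<And>j k. j < ?m \<Longrightarrow> k < ?m \<Longrightarrow> 0 < ?a j \<Longrightarrow> ?a k < 0 \<Longrightarrow> f j < - ?a k \<or> f k < ?a j"
  proof -
    assume z: "\<And>j. j < ?m \<Longrightarrow> ?a j = 0 \<Longrightarrow> 0 < f j \<Longrightarrow> thesis"
      and pn: "\<And>j k. j < ?m \<Longrightarrow> k < ?m \<Longrightarrow> 0 < ?a j \<Longrightarrow> ?a k < 0 \<Longrightarrow> - ?a k \<le> f j \<Longrightarrow> ?a j \<le> f k \<Longrightarrow> thesis"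
      and b: "(\<And>j. j < ?m \<Longrightarrow> ?a j = 0 \<Longrightarrow> f j = 0) \<Longrightarrow>
       (\<And>j k. j < ?m \<Longrightarrow> k < ?m \<Longrightarrow> 0 < ?a j \<Longrightarrow> ?a k < 0 \<Longrightarrow> f j < - ?a k \<or> f k < ?a j) \<Longrightarrow> thesis"
    show thesis
    proof (cases "\<exists>j<?m. ?a j = 0 \<and> 0 < f j")
      case True
      then show thesis using z by blast
    next
      case False
      then have 1: "f j = 0" if "j < ?m" "?a j = 0" for j using f[of j] that by (metis order_le_less)
      show thesis
      proof (rule ccontr)
        assume "\<not> thesis"
        then have "f j < - ?a k \<or> f k < ?a j" if "j < ?m" "k < ?m" "0 < ?a j" "?a k < 0" for j k
          using pn[OF that] by linarith
        then show False using b 1 \<open>\<not> thesis\<close> by blast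
      qed
    qed
  qed
  then show ?case
  proof cases
    case z
    let ?h = "\<lambda>k. f k - (if k = j then 1 else 0)"
    have "comb (\<lambda>k. f k - ?h k) cs = cs ! j"
      using comb_single[OF z(1), of 1] by auto
    then show ?thesis using z f by (intro IH[of ?h j]) (auto simp: elim_coord_def)
  next
    case pn
    then have "j \<noteq> k" by auto
    let ?h = "\<lambda>l. f l - ((if l = j then - ?a k else 0) + (if l = k then ?a j else 0))"
    have eq: "(\<lambda>l. f l - ?h l) = (\<lambda>l. (if l = j then - ?a k else 0) + (if l = k then ?a j else 0))" by auto
    have "comb (\<lambda>l. f l - ?h l) cs x = - ?a k * (cs ! j) x + ?a j * (cs ! k) x" for x
      unfolding eq comb_plus comb_single[OF pn(1)] comb_single[OF pn(2)] by simp
    then have "(\<lambda>x. comb (\<lambda>l. f l - ?h l) cs x) = (\<lambda>x. - ?a k * (cs ! j) x + ?a j * (cs ! k) x)" by (rule ext)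
    moreover have "\<dots> \<in> elim_coord i (set cs)"
      unfolding elim_coord_def using pn by (intro UnI2 CollectI exI[of _ "cs ! j"] exI[of _ "cs ! k"]) simp
    ultimately show ?thesis using pn f \<open>j \<noteq> k\<close>
      by (intro IH[of ?h j]) auto
  next
    case b
    have le_s: "\<bar>?a j\<bar> \<le> s" if "j < ?m" for j
      unfolding s_def using that by (intro member_le_sum) auto
    have B: "f k \<le> B" if k: "k < ?m" for k
    proof (cases "?a k = 0")
      case True
      have "0 \<le> s" using le_s[OF k] by linarith
      then have "0 \<le> s * s" by simp
      with \<open>0 \<le> s\<close> show ?thesis using b(1)[OF k True] less.prems(2) by linarith
    next
      case False
      have "f k \<le> \<bar>comb f cs i\<bar> + s * s + s"
      proof (cases "\<forall>j<?m. 0 < ?a j \<longrightarrow> f j \<le> s")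
        case True
        then show ?thesis
          using coeff_bound[of f ?m ?a k] f k False by (simp add: comb_def s_def)
      next
        \<comment> \<open>A positive column with coefficient above \<open>s\<close> has enough
          copies to pair with any negative column. As no pair can be taken out, each negative column
          has coefficient below \<open>?a j\<close>, hence at most \<open>s\<close>, and
          \<open>coeff_bound\<close> applies with all signs reversed.\<close>
        case False': False
        then obtain j where j: "j < ?m" "0 < ?a j" "s < f j" by (auto simp: not_le)
        have "f l \<le> s" if "l < ?m" "?a l < 0" for l
        proof -
          have "\<not> f j < - ?a l" using le_s[OF that(1)] j(3) that(2) by linarith
          then show ?thesis using b(2)[OF j(1) that(1) j(2) that(2)] le_s[OF j(1)] by linarith
        qed
        then show ?thesis
          using coeff_bound[of f ?m "\<lambda>j. - ?a j" k] f k False by (simp add: comb_def s_def sum_negf)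
      qed
      then show ?thesis using less.prems(2) by linarith
    qed
    moreover have "(\<lambda>k. comb f cs k - comb f cs k) \<in> nspan (elim_coord i (set cs))"
      using nspan.zero by simp
    ultimately show ?thesis using f by blast
  qed
qed

text \<open>One membership becomes finitely many, in a semigroup whose generators vanish at i. A
  remainder that does not vanish at i fails the new membership, so the equation at i is enforced
  implicitly.\<close>

lemma nspan_eliminate:
  fixes cs :: "(nat \<Rightarrow> int) list" and i :: nat
  defines "s \<equiv> \<Sum>j<length cs. \<bar>(cs ! j) i\<bar>"
  assumes B: "\<bar>b i\<bar> + s * s + s \<le> B"
  shows "b \<in> nspan (set cs) \<longleftrightarrow>
    (\<exists>g. (\<forall>j. 0 \<le> g j) \<and> (\<forall>j<length cs. g j \<le> B) \<and> (\<lambda>k. b k - comb g cs k) \<in> nspan (elim_coord i (set cs)))"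
    (is "?L \<longleftrightarrow> ?R")
proof
  assume ?L
  then obtain f where f: "\<And>j. 0 \<le> f j" "b = comb f cs" 
    by (rule nspan_set_combE) auto
  show ?R using reduce_coeffs[of f cs i B] f B by (simp add: s_def)
next
  assume ?R
  then obtain g where g: "\<forall>j. 0 \<le> g j" "(\<lambda>k. b k - comb g cs k) \<in> nspan (elim_coord i (set cs))" by blast
  have "(\<lambda>k. comb g cs k + (b k - comb g cs k)) \<in> nspan (set cs)"
    using g nspan_least[OF elim_coord_nspan] by (intro nspan_plus comb_in_nspan) auto
  then show ?L by simp
qed

subsection \<open>Integer points of the real cone\<close>

inductive_set rspan :: "(nat \<Rightarrow> int) set \<Rightarrow> (nat \<Rightarrow> real) set" for S where
  zero: "(\<lambda>i. 0) \<in> rspan S"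
| add: "c \<in> S \<Longrightarrow> 0 \<le> t \<Longrightarrow> v \<in> rspan S \<Longrightarrow> (\<lambda>i. t * real_of_int (c i) + v i) \<in> rspan S"

lemma rspan_plus:
  assumes "u \<in> rspan S" "v \<in> rspan S" shows "(\<lambda>i. u i + v i) \<in> rspan S"
  using assms(1)
proof induction
  case (add c t w)
  then show ?case using rspan.add[of c S t "\<lambda>i. w i + v i"] by (simp add: add.assoc)
qed (simp add: assms(2))

lemma rspan_sum:
  assumes "finite J" "\<And>j. j \<in> J \<Longrightarrow> 0 \<le> t j" "\<And>j. j \<in> J \<Longrightarrow> g j \<in> S"
  shows "(\<lambda>i. \<Sum>j\<in>J. t j * real_of_int (g j i)) \<in> rspan S"
  using assms
proof (induction J)
  case empty
  show ?case using rspan.zero by simp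
next
  case (insert j J)
  then show ?case using rspan.add[of "g j" S "t j" "\<lambda>i. \<Sum>j\<in>J. t j * real_of_int (g j i)"] by simp
qed

lemma rspan_finite_sumE:
  assumes "v \<in> rspan S"
  obtains F x where "finite F" "F \<subseteq> S" "\<And>c. 0 \<le> x c" "v = (\<lambda>i. \<Sum>c\<in>F. x c * real_of_int (c i))"
proof -
  have "\<exists>F x. finite F \<and> F \<subseteq> S \<and> (\<forall>c. 0 \<le> x c) \<and> (\<forall>c. c \<notin> F \<longrightarrow> x c = 0) \<and> v = (\<lambda>i. \<Sum>c\<in>F. x c * real_of_int (c i))"
    using assms
  proof induction
    case zero
    show ?case by (rule exI[of _ "{}"], rule exI[of _ "\<lambda>_. 0"]) simp
  next
    case (add c t v)
    then obtain F x where F: "finite F" "F \<subseteq> S" "\<forall>c. 0 \<le> x c" "\<forall>c. c \<notin> F \<longrightarrow> x c = 0"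
      "v = (\<lambda>i. \<Sum>c\<in>F. x c * real_of_int (c i))" by blast
    let ?x = "\<lambda>d. x d + (if d = c then t else 0)"
    have "(\<Sum>d\<in>insert c F. ?x d * real_of_int (d i)) = t * real_of_int (c i) + v i" for i
    proof -
      have "(\<Sum>d\<in>insert c F. ?x d * real_of_int (d i)) =
          (\<Sum>d\<in>insert c F. x d * real_of_int (d i)) + (\<Sum>d\<in>insert c F. if d = c then t * real_of_int (c i) else 0)"
        by (subst sum.distrib[symmetric]) (auto intro!: sum.cong simp: algebra_simps)
      also have "(\<Sum>d\<in>insert c F. x d * real_of_int (d i)) = v i"
        using F(1,4) by (simp add: F(5) sum.insert_if)
      finally show ?thesis using F(1) by simp
    qed
    then have "(\<lambda>i. t * real_of_int (c i) + v i) = (\<lambda>i. \<Sum>d\<in>insert c F. ?x d * real_of_int (d i))" by (simp only:)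
    moreover have "finite (insert c F)" "insert c F \<subseteq> S" "\<forall>d. 0 \<le> ?x d" "\<forall>d. d \<notin> insert c F \<longrightarrow> ?x d = 0"
      using F(1-4) add(1,2) by auto
    ultimately show ?case by (intro exI[of _ "insert c F"] exI[of _ ?x] conjI)
  qed
  then show ?thesis using that by blast
qed

text \<open>Over the reals the elimination is exact. \<open>T\<close> is the total weight of the
  positive columns at i and, since v vanishes there, also that of the negative ones; giving the pair
  (c, c') the weight \<open>x c * x c' / T\<close> redistributes all of it.\<close>

lemma rspan_eliminate:
  assumes "v \<in> rspan S" "v i = 0"
  shows "v \<in> rspan (elim_coord i S)"
proof -
  obtain F x where F: "finite F" "F \<subseteq> S" and x: "\<And>c. 0 \<le> x c"
    and v: "v = (\<lambda>i. \<Sum>c\<in>F. x c * real_of_int (c i))"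
    by (rule rspan_finite_sumE[OF assms(1)]) blast
  let ?Z = "{c \<in> F. c i = 0}" and ?P = "{c \<in> F. 0 < c i}" and ?N = "{c \<in> F. c i < 0}"
  have split: "(\<Sum>c\<in>F. h c) = (\<Sum>c\<in>?Z. h c) + (\<Sum>c\<in>?P. h c) + (\<Sum>c\<in>?N. h c)" for h :: "_ \<Rightarrow> real"
  proof -
    have "F = ?Z \<union> ?P \<union> ?N" by auto
    then have "(\<Sum>c\<in>F. h c) = (\<Sum>c\<in>?Z \<union> ?P \<union> ?N. h c)" by simp
    also have "\<dots> = (\<Sum>c\<in>?Z. h c) + (\<Sum>c\<in>?P. h c) + (\<Sum>c\<in>?N. h c)"
      using F(1) by (subst sum.union_disjoint; (subst sum.union_disjoint)?) auto
    finally show ?thesis .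
  qed
  define T where "T = (\<Sum>c\<in>?P. x c * real_of_int (c i))"
  have TN: "(\<Sum>c\<in>?N. x c * - real_of_int (c i)) = T"
    using assms(2) split[of "\<lambda>c. x c * real_of_int (c i)"] by (simp add: v T_def sum_negf)
  let ?g = "\<lambda>(c, c') k. - c' i * c k + c i * c' k :: int"
  let ?t = "\<lambda>(c, c'). x c * x c' / T"
  have T0: "0 \<le> T" unfolding T_def using x by (intro sum_nonneg) auto
  have "v k = (\<Sum>c\<in>?Z. x c * real_of_int (c k)) + (\<Sum>p\<in>?P \<times> ?N. ?t p * real_of_int (?g p k))" for k
  \<comment> \<open>If \<open>T\<close> is 0, all columns that are nonzero at i have weight 0, and
    the pair weights vanish too, division by 0 being 0.\<close>
  proof (cases "T = 0")
    case True
    have "x c = 0" if "c \<in> ?P" for c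
    proof -
      have "x c * real_of_int (c i) = 0"
        using True that sum_nonneg_eq_0_iff[of ?P "\<lambda>c. x c * real_of_int (c i)"] F(1) x
        unfolding T_def by auto
      then show ?thesis using that by simp
    qed
    moreover have "x c = 0" if "c \<in> ?N" for c
    proof -
      have "x c * - real_of_int (c i) = 0"
        using TN[unfolded True] that sum_nonneg_eq_0_iff[of ?N "\<lambda>c. x c * - real_of_int (c i)"] F(1) x
        by (auto simp: mult_le_0_iff zero_le_mult_iff)
      then show ?thesis using that by simp
    qed
    ultimately have "(\<Sum>c\<in>?P. x c * real_of_int (c k)) = 0" "(\<Sum>c\<in>?N. x c * real_of_int (c k)) = 0"
      by (intro sum.neutral; simp)+
    then show ?thesis by (simp add: v split[of "\<lambda>c. x c * real_of_int (c k)"] True)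
  next
    case False
    have "(\<Sum>p\<in>?P \<times> ?N. ?t p * real_of_int (?g p k)) =
        (\<Sum>c\<in>?P. \<Sum>c'\<in>?N. (x c * real_of_int (c k)) * (x c' * - real_of_int (c' i)) / T
          + (x c * real_of_int (c i)) * (x c' * real_of_int (c' k)) / T)"
      unfolding sum.cartesian_product by (rule sum.cong) (auto simp: algebra_simps diff_divide_distrib)
    also have "\<dots> = (\<Sum>c\<in>?P. x c * real_of_int (c k)) * (\<Sum>c'\<in>?N. x c' * - real_of_int (c' i)) / T
          + (\<Sum>c\<in>?P. x c * real_of_int (c i)) * (\<Sum>c'\<in>?N. x c' * real_of_int (c' k)) / T"
      by (simp only: sum.distrib sum_product sum_divide_distrib)
    also have "\<dots> = (\<Sum>c\<in>?P. x c * real_of_int (c k)) + (\<Sum>c'\<in>?N. x c' * real_of_int (c' k))"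
      unfolding TN T_def[symmetric] using False by simp
    finally show ?thesis by (simp add: v split[of "\<lambda>c. x c * real_of_int (c k)"])
  qed
  then have "v = (\<lambda>k. (\<Sum>c\<in>?Z. x c * real_of_int (c k)) + (\<Sum>p\<in>?P \<times> ?N. ?t p * real_of_int (?g p k)))" by blast
  also have "\<dots> \<in> rspan (elim_coord i S)"
  proof (rule rspan_plus; rule rspan_sum)
    show "?g p \<in> elim_coord i S" if "p \<in> ?P \<times> ?N" for p
    proof -
      obtain c c' where "p = (c, c')" "c \<in> S" "c' \<in> S" "0 < c i" "c' i < 0" using \<open>p \<in> ?P \<times> ?N\<close> F(2) by auto
      then show ?thesis unfolding elim_coord_def
        by (intro UnI2 CollectI exI[of _ c] exI[of _ c']) simp
    qed
  qed (use F x T0 in \<open>auto simp: elim_coord_def\<close>)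
  finally show ?thesis .
qed

text \<open>Passes from a real to an integral witness without rationalising coefficients: after d
  eliminations all generators are integral elements of \<open>nspan S\<close> that vanish below d,
  and one of them must be positive at w because v is.\<close>

lemma rspan_nspan_pos:
  assumes v: "v \<in> rspan S" and "\<And>i. i < d \<Longrightarrow> v i = 0" "0 < v w"
  obtains u where "u \<in> nspan S" "\<And>i. i < d \<Longrightarrow> u i = 0" "0 < u w"
proof -
  have "\<exists>S'. S' \<subseteq> nspan S \<and> (\<forall>c\<in>S'. \<forall>i<m. c i = 0) \<and> v \<in> rspan S'" if "m \<le> d" for m
    using that
  proof (induction m)
    case 0
    show ?case using v by (intro exI[of _ S]) (auto intro: nspan_base)
  next
    case (Suc m)
    then obtain S' where S': "S' \<subseteq> nspan S" "\<forall>c\<in>S'. \<forall>i<m. c i = 0" "v \<in> rspan S'" by auto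
    let ?E = "elim_coord m S'"
    have "?E \<subseteq> nspan S" using elim_coord_nspan nspan_least[OF S'(1)] by blast
    moreover have "c i = 0" if "c \<in> ?E" "i < Suc m" for c i
    proof (cases "i = m")
      case True
      then show ?thesis using elim_coord_zero that by blast
    next
      case False
      then have "i < m" using that by simp
      moreover have "c \<in> nspan S'" using that elim_coord_nspan by blast
      ultimately show ?thesis using S'(2) by (intro nspan_zero_coord[of c S']) auto
    qed
    moreover have "v \<in> rspan ?E" using assms(2) Suc.prems by (intro rspan_eliminate S'(3)) auto
    ultimately show ?case by (intro exI[of _ ?E]) simp
  qed
  from this[OF order_refl]
  obtain S' where S': "S' \<subseteq> nspan S" "\<forall>c\<in>S'. \<forall>i<d. c i = 0" "v \<in> rspan S'" by (elim exE conjE)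
  have "\<exists>c\<in>S'. 0 < c w"
  proof (rule ccontr)
    assume neg: "\<not> ?thesis"
    from S'(3) have "v w \<le> 0"
    proof induction
      case (add c t v)
      then have "t * real_of_int (c w) \<le> 0" using neg by (simp add: mult_le_0_iff not_less)
      then show ?case using add by simp
    qed simp
    then show False using assms(3) by simp
  qed
  then obtain c where "c \<in> S'" "0 < c w" by blast
  then show ?thesis using that[of c] S' by auto
qed

text \<open>Homogenisation: the extra column is -z with a 1 in the free coordinate d. Adding it once
  to the given real combination yields 0 below d and 1 at d. An integral vector of this kind uses
  the extra column k > 0 times, and its vanishing below d says that the other columns sum to k
  z.\<close>

lemma rspan_int_multiple:
  assumes C: "\<And>c i. c \<in> C \<Longrightarrow> d \<le> i \<Longrightarrow> c i = 0" and z: "\<And>i. d \<le> i \<Longrightarrow> z i = 0"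
    and "(\<lambda>i. real_of_int (z i)) \<in> rspan C"
  obtains k where "0 < k" "(\<lambda>i. k * z i) \<in> nspan C"
proof -
  let ?a = "\<lambda>i. if i = d then 1 else - z i"
  let ?S = "insert ?a C"
  have mono: "v \<in> rspan ?S" if "v \<in> rspan C" for v
    using that by induction (auto intro: rspan.intros)
  have "(\<lambda>i. 1 * real_of_int (?a i) + real_of_int (z i)) \<in> rspan ?S"
    by (intro rspan.add mono assms(3)) auto
  then obtain u where u: "u \<in> nspan ?S" "\<And>i. i < d \<Longrightarrow> u i = 0" "0 < u d"
    by (rule rspan_nspan_pos[where d = d and w = d]) (auto simp: z)
  then obtain k q where kq: "0 \<le> k" "q \<in> nspan C" "u = (\<lambda>i. k * ?a i + q i)"
    unfolding nspan_insert by blast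
  have q0: "q i = 0" if "d \<le> i" for i using that C by (intro nspan_zero_coord[OF kq(2)]) auto
  have "0 < k" using u(3) q0[of d] by (simp add: kq(3))
  moreover have "q = (\<lambda>i. k * z i)"
  proof
    fix i
    show "q i = k * z i"
    proof (cases "i < d")
      case True
      then show ?thesis using u(2)[OF True] by (simp add: kq(3))
    qed (simp add: q0 z)
  qed
  ultimately show ?thesis using that[of k] kq(2) by simp
qed

section \<open>Saturation and holes\<close>

text \<open>The saturation in integral terms: the first condition is the lattice; the second
  replaces the real cone, as justified by \<open>rspan_int_multiple\<close>.\<close>

definition sat_span :: "(nat \<Rightarrow> int) set \<Rightarrow> (nat \<Rightarrow> int) set" where
  "sat_span C = {z. (\<exists>a \<in> nspan C. \<exists>b \<in> nspan C. z = (\<lambda>i. a i - b i)) \<and> (\<exists>k>0. (\<lambda>i. k * z i) \<in> nspan C)}"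

lemma sat_span_plus:
  assumes "z \<in> sat_span C" "q \<in> nspan C" shows "(\<lambda>i. z i + q i) \<in> sat_span C"
proof -
  from assms(1) obtain a b k where abk: "a \<in> nspan C" "b \<in> nspan C" "z = (\<lambda>i. a i - b i)"
    "k > 0" "(\<lambda>i. k * z i) \<in> nspan C" unfolding sat_span_def by blast
  have "(\<lambda>i. a i + q i) \<in> nspan C" by (intro nspan_plus abk assms(2))
  moreover have "(\<lambda>i. k * z i + k * q i) \<in> nspan C"
    using abk(4) by (intro nspan_plus nspan_scale abk assms(2)) simp
  ultimately show ?thesis unfolding sat_span_def using abk(2,4)
    by (intro CollectI conjI bexI[of _ "\<lambda>i. a i + q i"] bexI[of _ b] exI[of _ k])
       (simp_all add: abk(3) algebra_simps)
qed

text \<open>If k z has coefficients f, the quotients \<open>f j div k\<close> give q and the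
  remainders \<open>f j mod k\<close> give k p. Remainders are below k, so division by k bounds p by
  the absolute row sums.\<close>

lemma sat_span_decompose:
  assumes "z \<in> sat_span (set cs)"
  obtains p q where "p \<in> sat_span (set cs)" "q \<in> nspan (set cs)" "z = (\<lambda>i. p i + q i)"
    "\<And>i. \<bar>p i\<bar> \<le> (\<Sum>j<length cs. \<bar>(cs ! j) i\<bar>)"
proof -
  from assms obtain a b k where abk: "a \<in> nspan (set cs)" "b \<in> nspan (set cs)" "z = (\<lambda>i. a i - b i)"
    "k > 0" "(\<lambda>i. k * z i) \<in> nspan (set cs)" unfolding sat_span_def by blast
  obtain f where f: "\<And>j. 0 \<le> f j" "(\<lambda>i. k * z i) = comb f cs"
    by (rule nspan_set_combE[OF abk(5)]) auto
  define q where "q = comb (\<lambda>j. f j div k) cs"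
  define p where "p = (\<lambda>i. z i - q i)"
  have q: "q \<in> nspan (set cs)" unfolding q_def using f(1) abk(4)
    by (intro comb_in_nspan) (auto simp: pos_imp_zdiv_nonneg_iff)
  have kp: "k * p i = comb (\<lambda>j. f j mod k) cs i" for i
  proof -
    have "comb f cs i = comb (\<lambda>j. k * (f j div k) + f j mod k) cs i" by simp
    also have "\<dots> = k * q i + comb (\<lambda>j. f j mod k) cs i"
      unfolding comb_plus q_def by (simp add: comb_def sum_distrib_left mult.assoc)
    finally show ?thesis using fun_cong[OF f(2), of i] by (simp add: p_def algebra_simps)
  qed
  have "(\<lambda>i. k * p i) \<in> nspan (set cs)"
    unfolding kp using abk(4) by (intro comb_in_nspan) auto
  moreover have "(\<lambda>i. b i + q i) \<in> nspan (set cs)" by (intro nspan_plus abk q)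
  ultimately have p: "p \<in> sat_span (set cs)" unfolding sat_span_def using abk(1,4)
    by (intro CollectI conjI bexI[of _ a] bexI[of _ "\<lambda>i. b i + q i"] exI[of _ k])
       (simp_all add: p_def abk(3) algebra_simps)
  have bound: "\<bar>p i\<bar> \<le> (\<Sum>j<length cs. \<bar>(cs ! j) i\<bar>)" for i
  proof -
    have "k * \<bar>p i\<bar> = \<bar>comb (\<lambda>j. f j mod k) cs i\<bar>"
      using abk(4) by (simp add: kp[symmetric] abs_mult)
    also have "\<dots> \<le> (\<Sum>j<length cs. \<bar>f j mod k * (cs ! j) i\<bar>)" unfolding comb_def by (rule sum_abs)
    also have "\<dots> \<le> (\<Sum>j<length cs. k * \<bar>(cs ! j) i\<bar>)"
      using abk(4) by (intro sum_mono) (auto simp: abs_mult intro!: mult_right_mono intro: less_imp_le)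
    also have "\<dots> = k * (\<Sum>j<length cs. \<bar>(cs ! j) i\<bar>)" by (simp add: sum_distrib_left)
    finally show ?thesis using abk(4) by simp
  qed
  have "z = (\<lambda>i. p i + q i)" by (simp add: p_def)
  then show ?thesis by (rule that[OF p q]) (rule bound)
qed

subsection \<open>Dickson's lemma\<close>

text \<open>Expresses that minimal elements are bounded, without mentioning them. In the induction,
  members that are large in the new coordinate are served by finitely many representatives, and the
  others fall into finitely many slices.\<close>

lemma dickson:
  fixes I :: "(nat \<Rightarrow> int) set"
  assumes "\<And>f j. f \<in> I \<Longrightarrow> 0 \<le> f j"
  shows "\<exists>B. \<forall>f\<in>I. \<exists>g\<in>I. \<forall>j<n. g j \<le> f j \<and> g j \<le> B"
  using assms
proof (induction n arbitrary: I)
  case 0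
  show ?case by auto
next
  case (Suc n)
  have "\<exists>B. \<forall>f\<in>I. \<exists>g\<in>I. \<forall>j<n. g j \<le> f j \<and> g j \<le> B"
    by (rule Suc.IH) (rule Suc.prems)
  then obtain B0 where B0: "\<forall>f\<in>I. \<exists>g\<in>I. \<forall>j<n. g j \<le> f j \<and> g j \<le> B0" ..
  \<comment> \<open>Members with first n entries at most \<open>B0\<close> show only finitely many
    patterns there. One representative per pattern is fixed, and \<open>K\<close> bounds their
    entries at n.\<close>
  define pat where "pat = (\<lambda>g :: nat \<Rightarrow> int. map g [0..<n])"
  let ?G = "{g \<in> I. \<forall>j<n. g j \<le> B0}"
  have "pat ` ?G \<subseteq> {xs. set xs \<subseteq> {0..B0} \<and> length xs = n}"
    using Suc.prems by (auto simp: pat_def)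
  then have fin: "finite (pat ` ?G)" using finite_lists_length_eq[of "{0..B0}" n] finite_subset by blast
  define rep where "rep xs = (SOME g. g \<in> I \<and> pat g = xs)" for xs
  have rep: "rep (pat g) \<in> I \<and> pat (rep (pat g)) = pat g" if "g \<in> I" for g
    unfolding rep_def by (rule someI[of _ g]) (simp add: that)
  define K where "K = Max (insert 0 ((\<lambda>xs. rep xs n) ` pat ` ?G))"
  have K: "rep (pat g) n \<le> K" if "g \<in> ?G" for g
    unfolding K_def using fin that by (intro Max_ge) auto
  \<comment> \<open>For members with \<open>f n < K\<close>: fixing the value k of this entry leaves
    n coordinates for the induction hypothesis, and only the k from 0 to K - 1 enter the final
    maximum.\<close>
  have "\<forall>k. \<exists>B. \<forall>f\<in>{f \<in> I. f n = k}. \<exists>g\<in>{f \<in> I. f n = k}. \<forall>j<n. g j \<le> f j \<and> g j \<le> B"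
  proof
    show "\<exists>B. \<forall>f\<in>{f \<in> I. f n = k}. \<exists>g\<in>{f \<in> I. f n = k}. \<forall>j<n. g j \<le> f j \<and> g j \<le> B" for k
      by (rule Suc.IH) (simp add: Suc.prems)
  qed
  then obtain Bk where Bk: "\<And>k f. f \<in> I \<Longrightarrow> f n = k \<Longrightarrow> \<exists>g\<in>I. g n = k \<and> (\<forall>j<n. g j \<le> f j \<and> g j \<le> Bk k)"
    unfolding choice_iff by blast
  define B where "B = Max (insert B0 (insert K (Bk ` {0..<K})))"
  have B: "B0 \<le> B" "K \<le> B" "\<And>k. 0 \<le> k \<Longrightarrow> k < K \<Longrightarrow> Bk k \<le> B"
    unfolding B_def by (intro Max_ge; simp)+
  have "\<exists>g\<in>I. \<forall>j<Suc n. g j \<le> f j \<and> g j \<le> B" if f: "f \<in> I" for f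
  proof (cases "K \<le> f n")
    case True
    obtain g where g: "g \<in> I" "\<forall>j<n. g j \<le> f j \<and> g j \<le> B0" using B0 f by blast
    let ?h = "rep (pat g)"
    have "?h j = g j" if "j < n" for j
      using arg_cong[OF rep[OF g(1), THEN conjunct2], of "\<lambda>xs. xs ! j"] that by (simp add: pat_def)
    moreover have "?h n \<le> K" using K g by simp
    ultimately show ?thesis using rep[OF g(1)] g(2) True B(1,2)
      by (intro bexI[of _ ?h]) (force simp: less_Suc_eq)+
  next
    case False
    obtain g where g: "g \<in> I" "g n = f n" "\<forall>j<n. g j \<le> f j \<and> g j \<le> Bk (f n)" using Bk[OF f] by blast
    have "Bk (f n) \<le> B" using B(3)[of "f n"] False Suc.prems[OF f] by simp
    then show ?thesis using g False B(2) by (intro bexI[of _ g]) (force simp: less_Suc_eq)+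
  qed
  then show ?case by blast
qed

text \<open>A coefficient vector f with the sum in the semigroup dominates such a vector g bounded
  by B. Then \<open>min (f j) B\<close> still dominates g, and the difference contributes a
  nonnegative combination of columns.\<close>

lemma truncation_bound:
  assumes "finite P"
  shows "\<exists>B\<ge>0. \<forall>p\<in>P. \<forall>f. (\<forall>j<length cs. 0 \<le> f j) \<longrightarrow> (\<lambda>i. p i + comb f cs i) \<in> nspan (set cs) \<longrightarrow>
     (\<lambda>i. p i + comb (\<lambda>j. min (f j) B) cs i) \<in> nspan (set cs)"
proof -
  let ?n = "length cs"
  \<comment> \<open>Asserted for every B' above B, so that a maximum serves all points of
    \<open>P\<close> at once.\<close>
  have "\<exists>B. \<forall>B'\<ge>B. \<forall>f. (\<forall>j<?n. 0 \<le> f j) \<longrightarrow> (\<lambda>i. p i + comb f cs i) \<in> nspan (set cs) \<longrightarrow>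
     (\<lambda>i. p i + comb (\<lambda>j. min (f j) B') cs i) \<in> nspan (set cs)" for p
  proof -
    let ?I = "{f. (\<forall>j. 0 \<le> f j) \<and> (\<lambda>i. p i + comb f cs i) \<in> nspan (set cs)}"
    obtain B where B: "\<forall>f\<in>?I. \<exists>g\<in>?I. \<forall>j<?n. g j \<le> f j \<and> g j \<le> B"
      using dickson[of ?I ?n] by blast
    have "(\<lambda>i. p i + comb (\<lambda>j. min (f j) B') cs i) \<in> nspan (set cs)"
      if B': "B \<le> B'" and f: "\<forall>j<?n. 0 \<le> f j" "(\<lambda>i. p i + comb f cs i) \<in> nspan (set cs)" for B' f
    proof -
      \<comment> \<open>The set \<open>?I\<close> demands nonnegative values everywhere, so f is set
        to 0 beyond the columns, where \<open>comb\<close> ignores it.\<close>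
      let ?f = "\<lambda>j. if j < ?n then f j else 0"
      have "comb ?f cs = comb f cs" by (simp add: comb_def)
      then have "?f \<in> ?I" using f by auto
      from bspec[OF B this] obtain g where g: "g \<in> ?I" "\<forall>j<?n. g j \<le> ?f j \<and> g j \<le> B" by (elim bexE)
      have "comb (\<lambda>j. min (f j) B' - g j) cs \<in> nspan (set cs)"
        using g(2) B'
        by (intro comb_in_nspan) (auto simp: min_def intro: order_trans[OF _ B'])
      then have "(\<lambda>i. (p i + comb g cs i) + comb (\<lambda>j. min (f j) B' - g j) cs i) \<in> nspan (set cs)"
        using g(1) by (intro nspan_plus[of "\<lambda>i. p i + comb g cs i"]) auto
      then show ?thesis by (simp add: comb_diff)
    qed
    then show ?thesis by (intro exI[of _ B] allI impI)
  qed
  then have "\<forall>p. \<exists>B. \<forall>B'\<ge>B. \<forall>f. (\<forall>j<?n. 0 \<le> f j) \<longrightarrow> (\<lambda>i. p i + comb f cs i) \<in> nspan (set cs) \<longrightarrow>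
     (\<lambda>i. p i + comb (\<lambda>j. min (f j) B') cs i) \<in> nspan (set cs)"
    by (rule allI)
  then obtain b where b: "\<And>p B' f. b p \<le> B' \<Longrightarrow> (\<forall>j<?n. 0 \<le> f j) \<Longrightarrow> (\<lambda>i. p i + comb f cs i) \<in> nspan (set cs) \<Longrightarrow>
     (\<lambda>i. p i + comb (\<lambda>j. min (f j) B') cs i) \<in> nspan (set cs)"
    unfolding choice_iff by blast
  have "b p \<le> Max (insert 0 (b ` P))" if "p \<in> P" for p using assms that by (intro Max_ge) auto
  moreover have "0 \<le> Max (insert 0 (b ` P))" using assms by (intro Max_ge) auto
  ultimately show ?thesis
    by (intro exI[of _ "Max (insert 0 (b ` P))"] conjI ballI allI impI b) auto
qed

subsection \<open>The decomposition of the holes\<close>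

text \<open>A piece whose base point avoids the semigroup avoids it entirely: membership with the
  negated columns added would mean that the base point plus a combination of the columns with
  \<open>f j = B\<close> lies in the semigroup.\<close>

definition separated :: "(nat \<Rightarrow> int) list \<Rightarrow> (nat \<Rightarrow> int) set \<Rightarrow> int \<Rightarrow> bool" where
  "separated cs P B \<longleftrightarrow> (\<forall>p\<in>P. \<forall>f. (\<forall>j<length cs. 0 \<le> f j \<and> f j \<le> B) \<longrightarrow>
     (\<lambda>i. p i + comb f cs i) \<notin> nspan (set cs) \<longrightarrow>
     (\<lambda>i. p i + comb f cs i) \<notin>
       nspan (set cs \<union> (\<lambda>c i. - c i) ` (!) cs ` {j. j < length cs \<and> f j = B}))"

lemma ex_separated:
  assumes "finite P" shows "\<exists>B\<ge>0. separated cs P B"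
proof -
  obtain B where B: "0 \<le> B" "\<And>p f. p \<in> P \<Longrightarrow> (\<forall>j<length cs. 0 \<le> f j) \<Longrightarrow>
     (\<lambda>i. p i + comb f cs i) \<in> nspan (set cs) \<Longrightarrow> (\<lambda>i. p i + comb (\<lambda>j. min (f j) B) cs i) \<in> nspan (set cs)"
    using truncation_bound[OF assms, of cs] by blast
  have "separated cs P B"
    unfolding separated_def
  proof (intro ballI allI impI notI)
    fix p f
    let ?J = "{j. j < length cs \<and> f j = B}"
    assume p: "p \<in> P" and f: "\<forall>j<length cs. 0 \<le> f j \<and> f j \<le> B"
      and notin: "(\<lambda>i. p i + comb f cs i) \<notin> nspan (set cs)"
      and "(\<lambda>i. p i + comb f cs i) \<in> nspan (set cs \<union> (\<lambda>c i. - c i) ` (!) cs ` ?J)"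
    then obtain a b where ab: "a \<in> nspan (set cs)" "b \<in> nspan ((!) cs ` ?J)"
      "(\<lambda>i. p i + comb f cs i) = (\<lambda>i. a i - b i)"
      unfolding nspan_Un_uminus by blast
    obtain g where g: "\<And>j. 0 \<le> g j" "\<And>j. j \<notin> ?J \<Longrightarrow> g j = 0" "b = comb g cs"
      by (rule nspan_combE[OF ab(2)]) auto
    have "p i + comb (\<lambda>j. f j + g j) cs i = a i" for i
      using fun_cong[OF ab(3), of i] by (simp add: comb_plus g(3))
    then have "(\<lambda>i. p i + comb (\<lambda>j. f j + g j) cs i) \<in> nspan (set cs)" using ab(1) by simp
    then have "(\<lambda>i. p i + comb (\<lambda>j. min (f j + g j) B) cs i) \<in> nspan (set cs)"
      using f g(1) by (intro B(2)[OF p]) auto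
    \<comment> \<open>g raises only coefficients that already equal \<open>B\<close>, so truncation
      at \<open>B\<close> undoes it.\<close>
    moreover have "min (f j + g j) B = f j" if "j < length cs" for j
    proof (cases "f j = B")
      case True
      then show ?thesis using g(1)[of j] by simp
    next
      case False
      then show ?thesis using g(2)[of j] f that by auto
    qed
    then have "comb (\<lambda>j. min (f j + g j) B) cs = comb f cs" by (simp add: comb_def)
    ultimately show False using notin by simp
  qed
  with B(1) show ?thesis by blast
qed

text \<open>The coefficients of q are cut at B and the excess goes into the monoid; the truncated
  base point is outside the semigroup, since otherwise z would be inside. Conversely
  \<open>separated\<close> keeps the whole piece outside the semigroup, and \<open>sat_span\<close>
  absorbs semigroup elements.\<close>

lemma holes_decomposition:
  assumes P: "P \<subseteq> sat_span (set cs)"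
    and cover: "\<And>z. z \<in> sat_span (set cs) \<Longrightarrow> \<exists>p\<in>P. \<exists>q\<in>nspan (set cs). z = (\<lambda>i. p i + q i)"
    and sep: "separated cs P B" and B: "0 \<le> B"
  shows "z \<in> sat_span (set cs) - nspan (set cs) \<longleftrightarrow>
    (\<exists>p\<in>P. \<exists>f. (\<forall>j<length cs. 0 \<le> f j \<and> f j \<le> B) \<and> (\<lambda>i. p i + comb f cs i) \<notin> nspan (set cs) \<and>
       (\<exists>m \<in> nspan ((!) cs ` {j. j < length cs \<and> f j = B}). z = (\<lambda>i. p i + comb f cs i + m i)))"
    (is "?L \<longleftrightarrow> ?R")
proof
  assume L: ?L
  then obtain p q where pq: "p \<in> P" "q \<in> nspan (set cs)" "z = (\<lambda>i. p i + q i)" using cover by blast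
  obtain g where g: "\<And>j. 0 \<le> g j" "q = comb g cs"
    by (rule nspan_set_combE[OF pq(2)]) auto
  let ?f = "\<lambda>j. min (g j) B"
  have rest: "comb (\<lambda>j. g j - ?f j) cs \<in> nspan ((!) cs ` {j. j < length cs \<and> ?f j = B})"
    by (rule comb_in_nspan) auto
  have z: "z = (\<lambda>i. p i + comb ?f cs i + comb (\<lambda>j. g j - ?f j) cs i)"
    by (simp add: pq(3) g(2) comb_diff)
  have "(\<lambda>i. p i + comb ?f cs i) \<notin> nspan (set cs)"
  proof
    assume "(\<lambda>i. p i + comb ?f cs i) \<in> nspan (set cs)"
    moreover have "comb (\<lambda>j. g j - ?f j) cs \<in> nspan (set cs)"
      by (rule nspan_mono[OF _ rest]) auto
    ultimately have "z \<in> nspan (set cs)" unfolding z by (rule nspan_plus)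
    with L show False by simp
  qed
  moreover have "\<forall>j<length cs. 0 \<le> ?f j \<and> ?f j \<le> B" using g(1) B by simp
  ultimately show ?R using pq(1) rest z
    by (intro bexI[OF _ pq(1)] exI[of _ ?f] conjI bexI[OF _ rest])
next
  assume ?R
  then obtain p f m where pf: "p \<in> P" "\<forall>j<length cs. 0 \<le> f j \<and> f j \<le> B"
    "(\<lambda>i. p i + comb f cs i) \<notin> nspan (set cs)"
    and m: "m \<in> nspan ((!) cs ` {j. j < length cs \<and> f j = B})" and z: "z = (\<lambda>i. p i + comb f cs i + m i)"
    by (elim bexE exE conjE)
  have mQ: "m \<in> nspan (set cs)" by (rule nspan_mono[OF _ m]) auto
  have "comb f cs \<in> nspan (set cs)" using pf(2) by (intro comb_in_nspan) auto
  then have "z \<in> sat_span (set cs)"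
    unfolding z using P pf(1) mQ by (intro sat_span_plus) auto
  moreover have "z \<notin> nspan (set cs)"
  proof
    assume "z \<in> nspan (set cs)"
    then have "(\<lambda>i. p i + comb f cs i) \<in> nspan (set cs \<union> (\<lambda>c i. - c i) ` (!) cs ` {j. j < length cs \<and> f j = B})"
      unfolding nspan_Un_uminus using m z by (intro bexI[of _ z] bexI[of _ m]) auto
    then show False using sep pf unfolding separated_def by blast
  qed
  ultimately show ?L by simp
qed

section \<open>The algorithm\<close>

text \<open>Integer vectors of dimension \<open>d\<close> are lists, padded with zeros when read as functions.\<close>

abbreviation coord :: "int list \<Rightarrow> nat \<Rightarrow> int" where
  "coord \<equiv> nth_default 0"

text \<open>The result has length d whatever the lengths of u and v; with \<open>a = 1\<close> and
  \<open>b = 0\<close> it pads or truncates u.\<close>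

definition lin2 :: "nat \<Rightarrow> int \<Rightarrow> int list \<Rightarrow> int \<Rightarrow> int list \<Rightarrow> int list" where
  "lin2 d a u b v = map (\<lambda>i. a * coord u i + b * coord v i) [0..<d]"

definition lcomb :: "nat \<Rightarrow> int list \<Rightarrow> int list list \<Rightarrow> int list" where
  "lcomb d x cs = map (\<lambda>i. sum_list (map (\<lambda>j. coord x j * coord (nth_default [] cs j) i) [0..<length cs])) [0..<d]"

definition box :: "int \<Rightarrow> int \<Rightarrow> nat \<Rightarrow> int list list" where
  "box l h n = ((\<lambda>L. concat (map (\<lambda>x. map ((#) x) L) (map (\<lambda>k. l + int k) [0..<nat (h + 1 + - l)]))) ^^ n) [[]]"

definition elim_cols :: "nat \<Rightarrow> nat \<Rightarrow> int list list \<Rightarrow> int list list" where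
  "elim_cols d i cs = filter (\<lambda>c. coord c i = 0) cs @
     concat (map (\<lambda>c. if 0 < coord c i
       then map (\<lambda>c'. lin2 d (- coord c' i) c (coord c i) c') (filter (\<lambda>c'. coord c' i < 0) cs) else []) cs)"

text \<open>The bound from \<open>nspan_eliminate\<close>, with the absolute sum of row i as
  \<open>s\<close>.\<close>

definition rhs_bound :: "nat \<Rightarrow> int list list \<Rightarrow> int list \<Rightarrow> int" where
  "rhs_bound i cs b = \<bar>coord b i\<bar> + sum_list (map (\<lambda>c. \<bar>coord c i\<bar>) cs) * sum_list (map (\<lambda>c. \<bar>coord c i\<bar>) cs)
     + sum_list (map (\<lambda>c. \<bar>coord c i\<bar>) cs)"

definition elim_rhs :: "nat \<Rightarrow> nat \<Rightarrow> int list list \<Rightarrow> int list \<Rightarrow> int list list" where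
  "elim_rhs d i cs b = map (\<lambda>x. lin2 d 1 b (- 1) (lcomb d x cs)) (box 0 (rhs_bound i cs b) (length cs))"

text \<open>The state pairs the current columns with a list of candidate right-hand sides, read
  disjunctively.\<close>

definition elim_step :: "nat \<Rightarrow> nat \<Rightarrow> int list list \<times> int list list \<Rightarrow> int list list \<times> int list list" where
  "elim_step d i s = (elim_cols d i (fst s), concat (map (elim_rhs d i (fst s)) (snd s)))"

text \<open>After d steps all columns are zero vectors, so it remains to see whether some candidate
  right-hand side is zero.\<close>

definition feasible :: "nat \<Rightarrow> int list list \<Rightarrow> int list \<Rightarrow> bool" where
  "feasible d cs b \<longleftrightarrow> \<not> list_all (\<lambda>b'. \<not> list_all (\<lambda>i. coord b' i = 0) [0..<d])
     (snd (fold (elim_step d) [0..<d] (cs, [b])))"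

definition neg_vec :: "nat \<Rightarrow> int list \<Rightarrow> int list" where
  "neg_vec d c = lin2 d (- 1) c 0 []"

text \<open>The second test has -z among the columns: z = k (-z) + q says that (k + 1) z = q lies in
  the semigroup.\<close>

definition in_saturation :: "nat \<Rightarrow> int list list \<Rightarrow> int list \<Rightarrow> bool" where
  "in_saturation d cs z \<longleftrightarrow> feasible d (cs @ map (neg_vec d) cs) z \<and> feasible d (neg_vec d z # cs) z"

text \<open>A crude bound for the row sums in \<open>sat_span_decompose\<close>, uniform in the
  coordinates, so that the box to be searched is a cube.\<close>

definition col_size :: "int list list \<Rightarrow> int" where
  "col_size cs = sum_list (map (\<lambda>c. sum_list (map abs c)) cs)"

definition base_points :: "nat \<Rightarrow> int list list \<Rightarrow> int list list" where
  "base_points d cs = filter (in_saturation d cs) (box (- col_size cs) (col_size cs) d)"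

definition gens :: "int list list \<Rightarrow> int \<Rightarrow> int list \<Rightarrow> int list list" where
  "gens cs B x = map (nth_default [] cs) (filter (\<lambda>j. coord x j = B) [0..<length cs])"

definition pieces :: "nat \<Rightarrow> int list list \<Rightarrow> int \<Rightarrow> (int list \<times> int list list) list" where
  "pieces d cs B = filter (\<lambda>q. \<not> feasible d cs (fst q))
     (concat (map (\<lambda>p. map (\<lambda>x. (lin2 d 1 p 1 (lcomb d x cs), gens cs B x)) (box 0 B (length cs))) (base_points d cs)))"

definition separating :: "nat \<Rightarrow> int list list \<Rightarrow> int \<Rightarrow> bool" where
  "separating d cs B \<longleftrightarrow>
     list_all (\<lambda>q. \<not> feasible d (cs @ map (neg_vec d) (snd q)) (fst q)) (pieces d cs B)"

definition hole_pieces :: "nat \<Rightarrow> int list list \<Rightarrow> (int list \<times> int list list) list" where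
  "hole_pieces d cs = pieces d cs (int (LEAST B. separating d cs (int B)))"

section \<open>Correctness of the list algorithm\<close>

lemma coord_map_upt: "coord (map f [0..<d]) i = (if i < d then f i else 0)"
  by (simp add: nth_default_def)

lemma coord_lin2: "coord (lin2 d a u b v) i = (if i < d then a * coord u i + b * coord v i else 0)"
  by (simp add: lin2_def coord_map_upt)

lemma length_lin2 [simp]: "length (lin2 d a u b v) = d"
  by (simp add: lin2_def)

lemma coord_beyond: "length u \<le> i \<Longrightarrow> coord u i = 0"
  by (simp add: nth_default_beyond)

lemma coord_neg_vec: "length c \<le> d \<Longrightarrow> coord (neg_vec d c) = (\<lambda>i. - coord c i)"
  by (auto simp: neg_vec_def coord_lin2 coord_beyond)

lemma length_neg_vec [simp]: "length (neg_vec d c) = d"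
  by (simp add: neg_vec_def)

lemma comb_coord_beyond:
  "\<forall>c\<in>set cs. length c \<le> d \<Longrightarrow> d \<le> i \<Longrightarrow> comb f (map coord cs) i = 0"
  unfolding comb_def by (rule sum.neutral) (metis coord_beyond le_trans lessThan_iff length_map mult_zero_right nth_map nth_mem)

lemma length_lcomb [simp]: "length (lcomb d x cs) = d"
  by (simp add: lcomb_def)

lemma coord_lcomb:
  assumes "\<forall>c\<in>set cs. length c \<le> d"
  shows "coord (lcomb d x cs) = comb (coord x) (map coord cs)"
proof
  fix i
  show "coord (lcomb d x cs) i = comb (coord x) (map coord cs) i"
  proof (cases "i < d")
    case True
    then have "coord (lcomb d x cs) i = (\<Sum>j\<leftarrow>[0..<length cs]. coord x j * coord (nth_default [] cs j) i)"
      by (simp add: lcomb_def coord_map_upt)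
    also have "\<dots> = (\<Sum>j<length cs. coord x j * coord (nth_default [] cs j) i)"
      by (simp add: interv_sum_list_conv_sum_set_nat atLeast0LessThan)
    also have "\<dots> = comb (coord x) (map coord cs) i"
      by (simp add: comb_def nth_default_nth)
    finally show ?thesis .
  next
    case False
    then show ?thesis using assms by (simp add: comb_coord_beyond coord_beyond)
  qed
qed

lemma set_box: "set (box l h n) = {x. length x = n \<and> (\<forall>j<n. l \<le> coord x j \<and> coord x j \<le> h)}"
proof (induction n)
  case 0
  show ?case by (auto simp: box_def)
next
  case (Suc n)
  have range: "set (map (\<lambda>k. l + int k) [0..<nat (h + 1 + - l)]) = {l..h}"
  proof (intro equalityI subsetI)
    fix x assume "x \<in> {l..h}"
    then show "x \<in> set (map (\<lambda>k. l + int k) [0..<nat (h + 1 + - l)])"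
      by (auto intro!: image_eqI[of _ _ "nat (x - l)"])
  qed auto
  have "set (box l h (Suc n)) = {x # xs | x xs. x \<in> {l..h} \<and> xs \<in> set (box l h n)}"
    unfolding range[symmetric] by (auto simp: box_def)
  also have "\<dots> = {x. length x = Suc n \<and> (\<forall>j<Suc n. l \<le> coord x j \<and> coord x j \<le> h)}"
    unfolding Suc.IH by (auto simp: length_Suc_conv nth_default_Cons All_less_Suc2)
  finally show ?case .
qed

text \<open>Bridges the enumerated coefficient lists of the program and the coefficient functions of
  the abstract lemmas.\<close>

lemma box_iff_fun:
  "(\<exists>x \<in> set (box l h n). Q x) \<longleftrightarrow> (\<exists>f. (\<forall>j<n. l \<le> f j \<and> f j \<le> h) \<and> Q (map f [0..<n]))"
proof
  assume "\<exists>x \<in> set (box l h n). Q x"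
  then obtain x where x: "length x = n" "\<forall>j<n. l \<le> coord x j \<and> coord x j \<le> h" "Q x" by (auto simp: set_box)
  then have "map (coord x) [0..<n] = x" using map_nth_default[of 0 x] by simp
  with x show "\<exists>f. (\<forall>j<n. l \<le> f j \<and> f j \<le> h) \<and> Q (map f [0..<n])"
    by (intro exI[of _ "coord x"]) simp
next
  assume "\<exists>f. (\<forall>j<n. l \<le> f j \<and> f j \<le> h) \<and> Q (map f [0..<n])"
  then obtain f where "\<forall>j<n. l \<le> f j \<and> f j \<le> h" "Q (map f [0..<n])" by blast
  then show "\<exists>x \<in> set (box l h n). Q x"
    by (intro bexI[of _ "map f [0..<n]"]) (auto simp: set_box nth_default_def)
qed

lemma comb_map_upt: "comb (coord (map f [0..<length cs])) cs = comb f cs"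
  by (simp add: comb_def nth_default_def)

lemma elim_cols_coord:
  assumes "\<forall>c\<in>set cs. length c \<le> d"
  shows "coord ` set (elim_cols d i cs) = elim_coord i (coord ` set cs)" "\<forall>c\<in>set (elim_cols d i cs). length c \<le> d"
proof -
  have lin: "coord (lin2 d a c b c') = (\<lambda>k. a * coord c k + b * coord c' k)"
    if "c \<in> set cs" "c' \<in> set cs" for a b c c'
  proof
    have "length c \<le> d" "length c' \<le> d" using assms that by auto
    then show "coord (lin2 d a c b c') k = a * coord c k + b * coord c' k" for k
      by (simp add: coord_lin2 coord_beyond)
  qed
  have "set (elim_cols d i cs) = {c \<in> set cs. coord c i = 0} \<union>
     {lin2 d (- coord c' i) c (coord c i) c' | c c'. c \<in> set cs \<and> c' \<in> set cs \<and> 0 < coord c i \<and> coord c' i < 0}"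
    by (auto simp: elim_cols_def split: if_splits)
  moreover have "coord ` {lin2 d (- coord c' i) c (coord c i) c' | c c'. c \<in> set cs \<and> c' \<in> set cs \<and> 0 < coord c i \<and> coord c' i < 0} =
     {\<lambda>k. - c' i * c k + c i * c' k | c c'. c \<in> coord ` set cs \<and> c' \<in> coord ` set cs \<and> 0 < c i \<and> c' i < 0}"
    (is "coord ` ?X = ?Y")
  proof (intro equalityI subsetI)
    fix v assume "v \<in> coord ` ?X"
    then obtain c c' where "v = coord (lin2 d (- coord c' i) c (coord c i) c')" "c \<in> set cs" "c' \<in> set cs"
      "0 < coord c i" "coord c' i < 0" by blast
    then show "v \<in> ?Y" by (intro CollectI exI[of _ "coord c"] exI[of _ "coord c'"]) (simp add: lin)
  next
    fix v assume "v \<in> ?Y"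
    then obtain c c' where "v = (\<lambda>k. - coord c' i * coord c k + coord c i * coord c' k)" "c \<in> set cs" "c' \<in> set cs"
      "0 < coord c i" "coord c' i < 0" by blast
    then show "v \<in> coord ` ?X" by (intro image_eqI[of _ _ "lin2 d (- coord c' i) c (coord c i) c'"]) (auto simp: lin)
  qed
  ultimately show "coord ` set (elim_cols d i cs) = elim_coord i (coord ` set cs)"
    by (auto simp: elim_coord_def image_Un)
  show "\<forall>c\<in>set (elim_cols d i cs). length c \<le> d"
    using assms by (auto simp: elim_cols_def split: if_splits)
qed

lemma elim_rhs_iff:
  assumes "\<forall>c\<in>set cs. length c \<le> d" "length b \<le> d"
  shows "coord b \<in> nspan (coord ` set cs) \<longleftrightarrow>
    (\<exists>b' \<in> set (elim_rhs d i cs b). coord b' \<in> nspan (elim_coord i (coord ` set cs)))"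
proof -
  let ?cs = "map coord cs" and ?B = "rhs_bound i cs b" and ?E = "elim_coord i (coord ` set cs)"
  have s: "sum_list (map (\<lambda>c. \<bar>coord c i\<bar>) cs) = (\<Sum>j<length ?cs. \<bar>(?cs ! j) i\<bar>)"
    by (simp add: sum_list_sum_nth atLeast0LessThan)
  have "coord b \<in> nspan (set ?cs) \<longleftrightarrow> (\<exists>g. (\<forall>j. 0 \<le> g j) \<and> (\<forall>j<length ?cs. g j \<le> ?B) \<and>
     (\<lambda>k. coord b k - comb g ?cs k) \<in> nspan (elim_coord i (set ?cs)))"
    by (rule nspan_eliminate) (simp add: rhs_bound_def s)
  also have "\<dots> \<longleftrightarrow> (\<exists>g. (\<forall>j<length cs. 0 \<le> g j \<and> g j \<le> ?B) \<and> (\<lambda>k. coord b k - comb g ?cs k) \<in> nspan ?E)"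
    (is "?L \<longleftrightarrow> ?R")
  proof
    assume ?R
    then obtain g where g: "\<forall>j<length cs. 0 \<le> g j \<and> g j \<le> ?B" "(\<lambda>k. coord b k - comb g ?cs k) \<in> nspan ?E" by blast
    \<comment> \<open>The abstract lemma wants g nonnegative at every position, while a box
      constrains only the column positions; the others are reset to 0.\<close>
    have "comb (\<lambda>j. if j < length cs then g j else 0) ?cs = comb g ?cs" by (simp add: comb_def)
    with g show ?L by (intro exI[of _ "\<lambda>j. if j < length cs then g j else 0"]) simp
  qed auto
  also have "\<dots> \<longleftrightarrow> (\<exists>x \<in> set (box 0 ?B (length cs)). (\<lambda>k. coord b k - comb (coord x) ?cs k) \<in> nspan ?E)"
    unfolding box_iff_fun using comb_map_upt[of _ ?cs] by simp
  also have "\<dots> \<longleftrightarrow> (\<exists>b' \<in> set (elim_rhs d i cs b). coord b' \<in> nspan ?E)"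
  proof -
    have "coord (lin2 d 1 b (- 1) (lcomb d x cs)) = (\<lambda>k. coord b k - comb (coord x) ?cs k)" for x
      using assms by (auto simp: coord_lin2 coord_lcomb coord_beyond comb_coord_beyond)
    then show ?thesis by (simp add: elim_rhs_def)
  qed
  finally show ?thesis by simp
qed

lemma feasible_iff:
  assumes "\<forall>c\<in>set cs. length c \<le> d" "length b \<le> d"
  shows "feasible d cs b \<longleftrightarrow> coord b \<in> nspan (coord ` set cs)"
proof -
  let ?s = "\<lambda>m. fold (elim_step d) [0..<m] (cs, [b])"
  \<comment> \<open>After m eliminations the columns vanish below m, and the original question is
    equivalent to solvability for some candidate. The length bounds force zeros from d on, so for m
    = d the columns vanish everywhere.\<close>
  have inv: "(\<forall>c\<in>set (fst (?s m)). length c \<le> d \<and> (\<forall>i<m. coord c i = 0)) \<and> (\<forall>b'\<in>set (snd (?s m)). length b' \<le> d) \<and>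
     (coord b \<in> nspan (coord ` set cs) \<longleftrightarrow> (\<exists>b' \<in> set (snd (?s m)). coord b' \<in> nspan (coord ` set (fst (?s m)))))" for m
  proof (induction m)
    case 0
    show ?case using assms by simp
  next
    case (Suc m)
    obtain C R where CR: "?s m = (C, R)" by fastforce
    then have Suc_eq: "?s (Suc m) = (elim_cols d m C, concat (map (elim_rhs d m C) R))"
      by (simp add: elim_step_def)
    have IH: "\<forall>c\<in>set C. length c \<le> d" "\<forall>c\<in>set C. \<forall>i<m. coord c i = 0" "\<forall>b'\<in>set R. length b' \<le> d"
      "coord b \<in> nspan (coord ` set cs) \<longleftrightarrow> (\<exists>b' \<in> set R. coord b' \<in> nspan (coord ` set C))"
      using Suc.IH by (simp_all add: CR)
    have zero: "coord c i = 0" if c: "c \<in> set (elim_cols d m C)" and "i < Suc m" for c i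
    proof -
      have e: "coord c \<in> elim_coord m (coord ` set C)" using c elim_cols_coord(1)[OF IH(1), of m] by blast
      show ?thesis
      proof (cases "i = m")
        case True
        then show ?thesis using elim_coord_zero[OF e] by simp
      next
        case False
        then have "\<And>c. c \<in> set C \<Longrightarrow> coord c i = 0" using IH(2) \<open>i < Suc m\<close> by simp
        moreover have "coord c \<in> nspan (coord ` set C)" using e elim_coord_nspan by blast
        ultimately show ?thesis by (intro nspan_zero_coord[of "coord c" "coord ` set C"]) auto
      qed
    qed
    have "(\<exists>b'\<in>set R. coord b' \<in> nspan (coord ` set C)) \<longleftrightarrow>
        (\<exists>b'\<in>set R. \<exists>b''\<in>set (elim_rhs d m C b'). coord b'' \<in> nspan (coord ` set (elim_cols d m C)))"
      using elim_rhs_iff[OF IH(1)] IH(3) by (simp add: elim_cols_coord(1)[OF IH(1)])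
    moreover have "\<forall>b'\<in>set (concat (map (elim_rhs d m C) R)). length b' \<le> d"
      by (auto simp: elim_rhs_def)
    ultimately show ?case
      unfolding Suc_eq using zero elim_cols_coord(2)[OF IH(1), of m] IH(4) by auto
  qed
  let ?C = "fst (?s d)"
  have C0: "coord c i = 0" if "c \<in> set ?C" for c i
    using inv[of d] that coord_beyond[of c i] by (cases "i < d") auto
  have "coord b' \<in> nspan (coord ` set ?C) \<longleftrightarrow> (\<forall>i<d. coord b' i = 0)" if "b' \<in> set (snd (?s d))" for b'
  proof
    assume "coord b' \<in> nspan (coord ` set ?C)"
    then show "\<forall>i<d. coord b' i = 0" using nspan_zero_coord[of "coord b'" "coord ` set ?C"] C0 by blast
  next
    assume "\<forall>i<d. coord b' i = 0"
    then have "coord b' = (\<lambda>i. 0)"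
      using inv[of d] that coord_beyond[of b'] by (metis le_trans not_le)
    then show "coord b' \<in> nspan (coord ` set ?C)" using nspan.zero by simp
  qed
  then show ?thesis using inv[of d] by (auto simp: feasible_def list_all_iff atLeast0LessThan)
qed

lemma in_saturation_iff:
  assumes "\<forall>c\<in>set cs. length c \<le> d" "length z \<le> d"
  shows "in_saturation d cs z \<longleftrightarrow> coord z \<in> sat_span (coord ` set cs)"
proof -
  let ?C = "coord ` set cs"
  have neg: "coord ` set (map (neg_vec d) cs) = (\<lambda>c i. - c i) ` ?C"
    using assms(1) by (force simp: image_image coord_neg_vec intro!: image_cong)
  have "feasible d (cs @ map (neg_vec d) cs) z \<longleftrightarrow> coord z \<in> nspan (?C \<union> (\<lambda>c i. - c i) ` ?C)"
    using assms by (subst feasible_iff) (auto simp: image_Un neg[symmetric])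
  also have "\<dots> \<longleftrightarrow> (\<exists>a \<in> nspan ?C. \<exists>b \<in> nspan ?C. coord z = (\<lambda>i. a i - b i))"
    by (rule nspan_Un_uminus)
  finally have 1: "feasible d (cs @ map (neg_vec d) cs) z \<longleftrightarrow> \<dots>" .
  have "feasible d (neg_vec d z # cs) z \<longleftrightarrow> coord z \<in> nspan (insert (\<lambda>i. - coord z i) ?C)"
    using assms by (subst feasible_iff) (auto simp: coord_neg_vec)
  also have "\<dots> \<longleftrightarrow> (\<exists>k\<ge>0. \<exists>q\<in>nspan ?C. coord z = (\<lambda>i. k * - coord z i + q i))"
    by (rule nspan_insert)
  also have "\<dots> \<longleftrightarrow> (\<exists>k>0. (\<lambda>i. k * coord z i) \<in> nspan ?C)" (is "?L \<longleftrightarrow> ?R")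
  proof
    assume ?L
    then obtain k q where kq: "0 \<le> k" "q \<in> nspan ?C" "coord z = (\<lambda>i. k * - coord z i + q i)" by blast
    have "q i = (k + 1) * coord z i" for i using fun_cong[OF kq(3), of i] by (simp add: algebra_simps)
    then have "q = (\<lambda>i. (k + 1) * coord z i)" by blast
    with kq(1,2) show ?R by (intro exI[of _ "k + 1"]) simp
  next
    assume ?R
    then obtain k where k: "0 < k" "(\<lambda>i. k * coord z i) \<in> nspan ?C" by blast
    have "coord z = (\<lambda>i. (k - 1) * - coord z i + k * coord z i)" by (simp add: algebra_simps)
    with k show ?L by (intro exI[of _ "k - 1"] conjI bexI[of _ "\<lambda>i. k * coord z i"]) simp_all
  qed
  finally show ?thesis using 1 by (simp add: in_saturation_def sat_span_def)
qed

lemma coord_map_upt_supp: "(\<And>i. d \<le> i \<Longrightarrow> f i = 0) \<Longrightarrow> coord (map f [0..<d]) = f"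
  by (rule ext) (simp add: coord_map_upt)

lemma set_base_points:
  assumes "\<forall>c\<in>set cs. length c \<le> d"
  shows "set (base_points d cs) = {p \<in> set (box (- col_size cs) (col_size cs) d). coord p \<in> sat_span (coord ` set cs)}"
  unfolding base_points_def using in_saturation_iff[OF assms] by (auto simp: set_box)

lemma col_size_bound:
  "(\<Sum>j<length cs. \<bar>coord (cs ! j) i\<bar>) \<le> col_size cs"
proof -
  have "\<bar>coord c i\<bar> \<le> sum_list (map abs c)" for c
  proof (cases "i < length c")
    case True
    then have "\<bar>c ! i\<bar> \<in> set (map abs c)" by simp
    then show ?thesis using True by (auto simp: nth_default_nth intro!: member_le_sum_list)
  next
    case False
    then show ?thesis by (auto simp: coord_beyond intro!: sum_list_nonneg)
  qed
  then have "(\<Sum>c\<leftarrow>cs. \<bar>coord c i\<bar>) \<le> (\<Sum>c\<leftarrow>cs. sum_list (map abs c))"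
    by (intro sum_list_mono)
  then show ?thesis by (simp add: col_size_def sum_list_sum_nth atLeast0LessThan)
qed

text \<open>The point p of \<open>sat_span_decompose\<close> vanishes from d on, because its bound
  there is a sum of zeros; so it is the reading of a list in the box.\<close>

lemma base_points_cover:
  assumes cs: "\<forall>c\<in>set cs. length c \<le> d" and z: "z \<in> sat_span (coord ` set cs)"
  shows "\<exists>p\<in>coord ` set (base_points d cs). \<exists>q\<in>nspan (coord ` set cs). z = (\<lambda>i. p i + q i)"
proof -
  obtain p q where pq: "p \<in> sat_span (set (map coord cs))" "q \<in> nspan (set (map coord cs))" "z = (\<lambda>i. p i + q i)"
    and bound: "\<And>i. \<bar>p i\<bar> \<le> (\<Sum>j<length (map coord cs). \<bar>(map coord cs ! j) i\<bar>)"
    using sat_span_decompose[of z "map coord cs"] z by auto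
  have le: "\<bar>p i\<bar> \<le> col_size cs" for i using bound[of i] col_size_bound[of cs i] by simp
  have b: "- col_size cs \<le> p i \<and> p i \<le> col_size cs" for i using le[of i] by linarith
  have "p i = 0" if "d \<le> i" for i
  proof -
    have "coord (cs ! j) i = 0" if "j < length cs" for j
      using cs that \<open>d \<le> i\<close> by (intro coord_beyond) (meson le_trans nth_mem)
    then show ?thesis using bound[of i] by simp
  qed
  then have p: "coord (map p [0..<d]) = p" by (rule coord_map_upt_supp)
  then have "map p [0..<d] \<in> set (base_points d cs)"
    using b pq(1) by (simp add: set_base_points[OF cs] set_box)
  with p have "p \<in> coord ` set (base_points d cs)" by (metis image_eqI)
  then show ?thesis using pq(2,3) by auto
qed

lemma coord_gens:
  assumes "length x = length cs"
  shows "coord ` set (gens cs B x) = (!) (map coord cs) ` {j. j < length (map coord cs) \<and> coord x j = B}"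
proof -
  have "set (gens cs B x) = (!) cs ` {j. j < length cs \<and> coord x j = B}"
    by (auto simp: gens_def nth_default_nth image_iff)
  then show ?thesis by (auto simp: image_image intro!: image_cong)
qed

lemma length_gens: "\<forall>c\<in>set cs. length c \<le> d \<Longrightarrow> c \<in> set (gens cs B x) \<Longrightarrow> length c \<le> d"
  by (auto simp: gens_def nth_default_nth)

lemma set_pieces:
  assumes cs: "\<forall>c\<in>set cs. length c \<le> d"
  shows "set (pieces d cs B) = {(lin2 d 1 p 1 (lcomb d x cs), gens cs B x) | p x.
    p \<in> set (base_points d cs) \<and> x \<in> set (box 0 B (length cs)) \<and>
    (\<lambda>i. coord p i + comb (coord x) (map coord cs) i) \<notin> nspan (coord ` set cs)}"
    and "p \<in> set (base_points d cs) \<Longrightarrow>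
      coord (lin2 d 1 p 1 (lcomb d x cs)) = (\<lambda>i. coord p i + comb (coord x) (map coord cs) i)"
proof -
  show h: "coord (lin2 d 1 p 1 (lcomb d x cs)) = (\<lambda>i. coord p i + comb (coord x) (map coord cs) i)"
    if "p \<in> set (base_points d cs)" for p x
  proof
    have "length p = d" using that by (simp add: set_base_points[OF cs] set_box)
    then show "coord (lin2 d 1 p 1 (lcomb d x cs)) i = coord p i + comb (coord x) (map coord cs) i" for i
      by (simp add: coord_lin2 coord_lcomb[OF cs] coord_beyond comb_coord_beyond[OF cs])
  qed
  have f: "feasible d cs (lin2 d 1 p 1 (lcomb d x cs)) \<longleftrightarrow>
      (\<lambda>i. coord p i + comb (coord x) (map coord cs) i) \<in> nspan (coord ` set cs)"
    if "p \<in> set (base_points d cs)" for p x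
    using that by (subst feasible_iff[OF cs]) (simp_all add: h)
  show "set (pieces d cs B) = {(lin2 d 1 p 1 (lcomb d x cs), gens cs B x) | p x.
    p \<in> set (base_points d cs) \<and> x \<in> set (box 0 B (length cs)) \<and>
    (\<lambda>i. coord p i + comb (coord x) (map coord cs) i) \<notin> nspan (coord ` set cs)}"
    unfolding set_eq_iff
  proof
    fix q
    have "q \<in> set (pieces d cs B) \<longleftrightarrow> (\<exists>p\<in>set (base_points d cs). \<exists>x\<in>set (box 0 B (length cs)).
        q = (lin2 d 1 p 1 (lcomb d x cs), gens cs B x) \<and> \<not> feasible d cs (lin2 d 1 p 1 (lcomb d x cs)))"
      by (auto simp: pieces_def) blast
    also have "\<dots> \<longleftrightarrow> (\<exists>p\<in>set (base_points d cs). \<exists>x\<in>set (box 0 B (length cs)).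
        q = (lin2 d 1 p 1 (lcomb d x cs), gens cs B x) \<and>
        (\<lambda>i. coord p i + comb (coord x) (map coord cs) i) \<notin> nspan (coord ` set cs))"
      by (intro bex_cong refl conj_cong) (simp add: f)
    finally show "q \<in> set (pieces d cs B) \<longleftrightarrow> q \<in> {(lin2 d 1 p 1 (lcomb d x cs), gens cs B x) | p x.
        p \<in> set (base_points d cs) \<and> x \<in> set (box 0 B (length cs)) \<and>
        (\<lambda>i. coord p i + comb (coord x) (map coord cs) i) \<notin> nspan (coord ` set cs)}"
      by blast
  qed
qed

lemma ball_box_iff_fun:
  "(\<forall>x \<in> set (box l h n). Q x) \<longleftrightarrow> (\<forall>f. (\<forall>j<n. l \<le> f j \<and> f j \<le> h) \<longrightarrow> Q (map f [0..<n]))"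
  using box_iff_fun[of l h n "\<lambda>x. \<not> Q x"] by blast

text \<open>The test runs over \<open>pieces\<close>, hence only over base points already found to
  be outside the semigroup; this is the premise inside \<open>separated\<close>.\<close>

lemma separating_iff:
  assumes cs: "\<forall>c\<in>set cs. length c \<le> d"
  shows "separating d cs B \<longleftrightarrow> separated (map coord cs) (coord ` set (base_points d cs)) B"
proof -
  let ?cs = "map coord cs" and ?n = "length cs"
  have f: "feasible d (cs @ map (neg_vec d) (gens cs B x)) (lin2 d 1 p 1 (lcomb d x cs)) \<longleftrightarrow>
     (\<lambda>i. coord p i + comb (coord x) ?cs i) \<in>
       nspan (set ?cs \<union> (\<lambda>c i. - c i) ` (!) ?cs ` {j. j < length ?cs \<and> coord x j = B})"
    if "p \<in> set (base_points d cs)" "x \<in> set (box 0 B ?n)" for p x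
  proof -
    have "coord ` set (map (neg_vec d) (gens cs B x)) = (\<lambda>c i. - c i) ` coord ` set (gens cs B x)"
      unfolding set_map image_image
      by (rule image_cong) (use length_gens[OF cs] in \<open>auto simp: coord_neg_vec\<close>)
    also have "\<dots> = (\<lambda>c i. - c i) ` (!) ?cs ` {j. j < length ?cs \<and> coord x j = B}"
      using that(2) by (subst coord_gens) (auto simp: set_box)
    finally show ?thesis using cs that(1)
      by (subst feasible_iff) (auto simp: image_Un set_pieces(2))
  qed
  have "separating d cs B \<longleftrightarrow> (\<forall>p\<in>set (base_points d cs). \<forall>x\<in>set (box 0 B ?n).
     (\<lambda>i. coord p i + comb (coord x) ?cs i) \<notin> nspan (set ?cs) \<longrightarrow>
     (\<lambda>i. coord p i + comb (coord x) ?cs i) \<notin>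
       nspan (set ?cs \<union> (\<lambda>c i. - c i) ` (!) ?cs ` {j. j < length ?cs \<and> coord x j = B}))"
    unfolding separating_def list_all_iff set_pieces(1)[OF cs] using f by fastforce
  also have "\<dots> \<longleftrightarrow> (\<forall>p\<in>coord ` set (base_points d cs). \<forall>x\<in>set (box 0 B ?n).
     (\<lambda>i. p i + comb (coord x) ?cs i) \<notin> nspan (set ?cs) \<longrightarrow>
     (\<lambda>i. p i + comb (coord x) ?cs i) \<notin>
       nspan (set ?cs \<union> (\<lambda>c i. - c i) ` (!) ?cs ` {j. j < length ?cs \<and> coord x j = B}))"
    by (simp only: ball_simps)
  also have "\<dots> \<longleftrightarrow> separated ?cs (coord ` set (base_points d cs)) B"
  proof -
    have "{j. j < length ?cs \<and> coord (map f [0..<?n]) j = B} = {j. j < length ?cs \<and> f j = B}" for f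
      by (auto simp: coord_map_upt)
    then show ?thesis
      unfolding separated_def ball_box_iff_fun using comb_map_upt[of _ ?cs] by simp
  qed
  finally show ?thesis .
qed

lemma ex_separating:
  assumes "\<forall>c\<in>set cs. length c \<le> d" shows "\<exists>B. separating d cs (int B)"
proof -
  obtain B where "0 \<le> B" "separated (map coord cs) (coord ` set (base_points d cs)) B"
    using ex_separated[of "coord ` set (base_points d cs)" "map coord cs"] by auto
  then show ?thesis using separating_iff[OF assms] by (intro exI[of _ "nat B"]) simp
qed

text \<open>The least separating B may be smaller than the one from Dickson's lemma. This is
  harmless: \<open>holes_decomposition\<close> uses B only through \<open>separated\<close> and its
  sign.\<close>

lemma hole_pieces_correct:
  assumes cs: "\<forall>c\<in>set cs. length c \<le> d"
  shows "z \<in> sat_span (coord ` set cs) - nspan (coord ` set cs) \<longleftrightarrow>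
    (\<exists>q\<in>set (hole_pieces d cs). \<exists>m\<in>nspan (coord ` set (snd q)). z = (\<lambda>i. coord (fst q) i + m i))"
proof -
  let ?cs = "map coord cs" and ?n = "length cs" and ?P = "coord ` set (base_points d cs)"
  define B where "B = int (LEAST B. separating d cs (int B))"
  have "separating d cs B" unfolding B_def by (rule LeastI_ex[OF ex_separating[OF cs]])
  then have sep: "separated ?cs ?P B" by (simp add: separating_iff[OF cs])
  have "z \<in> sat_span (set ?cs) - nspan (set ?cs) \<longleftrightarrow>
    (\<exists>p\<in>?P. \<exists>f. (\<forall>j<length ?cs. 0 \<le> f j \<and> f j \<le> B) \<and> (\<lambda>i. p i + comb f ?cs i) \<notin> nspan (set ?cs) \<and>
       (\<exists>m \<in> nspan ((!) ?cs ` {j. j < length ?cs \<and> f j = B}). z = (\<lambda>i. p i + comb f ?cs i + m i)))"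
  proof (rule holes_decomposition[OF _ _ sep])
    show "?P \<subseteq> sat_span (set ?cs)" using set_base_points[OF cs] by auto
    show "\<exists>p\<in>?P. \<exists>q\<in>nspan (set ?cs). z = (\<lambda>i. p i + q i)" if "z \<in> sat_span (set ?cs)" for z
      using base_points_cover[OF cs] that by simp
    show "0 \<le> B" by (simp add: B_def)
  qed
  also have "\<dots> \<longleftrightarrow> (\<exists>p\<in>?P. \<exists>x\<in>set (box 0 B ?n). (\<lambda>i. p i + comb (coord x) ?cs i) \<notin> nspan (set ?cs) \<and>
       (\<exists>m \<in> nspan ((!) ?cs ` {j. j < length ?cs \<and> coord x j = B}). z = (\<lambda>i. p i + comb (coord x) ?cs i + m i)))"
  proof -
    have "{j. j < length ?cs \<and> coord (map f [0..<?n]) j = B} = {j. j < length ?cs \<and> f j = B}" for f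
      by (auto simp: coord_map_upt)
    then show ?thesis unfolding box_iff_fun using comb_map_upt[of _ ?cs] by simp
  qed
  also have "\<dots> \<longleftrightarrow> (\<exists>p\<in>set (base_points d cs). \<exists>x\<in>set (box 0 B ?n).
       (\<lambda>i. coord p i + comb (coord x) ?cs i) \<notin> nspan (set ?cs) \<and>
       (\<exists>m \<in> nspan (coord ` set (gens cs B x)). z = (\<lambda>i. coord p i + comb (coord x) ?cs i + m i)))"
    unfolding bex_simps by (intro bex_cong refl) (simp add: coord_gens set_box)
  also have "\<dots> \<longleftrightarrow> (\<exists>p\<in>set (base_points d cs). \<exists>x\<in>set (box 0 B ?n).
       (\<lambda>i. coord p i + comb (coord x) ?cs i) \<notin> nspan (set ?cs) \<and>
       (\<exists>m \<in> nspan (coord ` set (gens cs B x)). z = (\<lambda>i. coord (lin2 d 1 p 1 (lcomb d x cs)) i + m i)))"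
    by (intro bex_cong refl) (simp add: set_pieces(2)[OF cs])
  also have "\<dots> \<longleftrightarrow> (\<exists>q\<in>set (pieces d cs B). \<exists>m\<in>nspan (coord ` set (snd q)). z = (\<lambda>i. coord (fst q) i + m i))"
    unfolding set_pieces(1)[OF cs] by fastforce
  finally show ?thesis by (simp add: hole_pieces_def B_def)
qed

lemma length_hole_pieces:
  assumes "\<forall>c\<in>set cs. length c = d" "q \<in> set (hole_pieces d cs)"
  shows "length (fst q) = d" "\<forall>c\<in>set (snd q). length c = d"
  using assms by (auto simp: hole_pieces_def pieces_def gens_def nth_default_nth)

subsection \<open>Computability of the algorithm\<close>

text \<open>Under a bound variable a parameter \<open>d x\<close> turns into
  \<open>d (fst p)\<close>, where p pairs the outer argument with the bound variable;
  \<open>assms[THEN computable_comp]\<close> covers this. The same pattern recurs below.\<close>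

lemma computable_lin2:
  assumes "computable d" "computable a" "computable u" "computable b" "computable v"
  shows "computable (\<lambda>x. lin2 (d x) (a x) (u x) (b x) (v x))"
  unfolding lin2_def by (intro assms assms[THEN computable_comp] computable_intros)

lemma computable_lcomb:
  assumes "computable d" "computable f" "computable cs"
  shows "computable (\<lambda>x. lcomb (d x) (f x) (cs x))"
  unfolding lcomb_def by (intro assms assms[THEN computable_comp] computable_intros)

lemma computable_box:
  assumes "computable l" "computable h" "computable n"
  shows "computable (\<lambda>x. box (l x) (h x) (n x))"
  unfolding box_def by (intro assms assms[THEN computable_comp] computable_intros)

lemma computable_elim_cols:
  assumes "computable d" "computable i" "computable cs"
  shows "computable (\<lambda>x. elim_cols (d x) (i x) (cs x))"
  unfolding elim_cols_def by (intro assms assms[THEN computable_comp] computable_intros computable_lin2)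

lemma computable_elim_rhs:
  assumes "computable d" "computable i" "computable cs" "computable b"
  shows "computable (\<lambda>x. elim_rhs (d x) (i x) (cs x) (b x))"
  unfolding elim_rhs_def rhs_bound_def
  by (intro assms assms[THEN computable_comp] computable_intros computable_lin2 computable_lcomb computable_box)

lemma computable_feasible:
  assumes "computable d" "computable cs" "computable b"
  shows "computable (\<lambda>x. feasible (d x) (cs x) (b x))"
  unfolding feasible_def elim_step_def
  by (intro assms assms[THEN computable_comp] computable_intros computable_elim_cols computable_elim_rhs)

lemma computable_neg_vec:
  assumes "computable d" "computable c" shows "computable (\<lambda>x. neg_vec (d x) (c x))"
  unfolding neg_vec_def by (intro assms computable_lin2 computable_const)

lemma computable_base_points:
  assumes "computable d" "computable cs" shows "computable (\<lambda>x. base_points (d x) (cs x))"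
  unfolding base_points_def in_saturation_def col_size_def
  by (intro assms assms[THEN computable_comp] computable_intros computable_feasible computable_neg_vec computable_box)

lemma computable_pieces:
  assumes "computable d" "computable cs" "computable B" shows "computable (\<lambda>x. pieces (d x) (cs x) (B x))"
  unfolding pieces_def gens_def
  by (intro assms assms[THEN computable_comp] computable_intros computable_feasible computable_lin2 computable_lcomb
      computable_box computable_base_points)

text \<open>The search for B must halt on every argument; the length condition provides this through
  \<open>ex_separating\<close>.\<close>

lemma computable_hole_pieces:
  assumes "computable d" "computable cs" "\<And>x c. c \<in> set (cs x) \<Longrightarrow> length c \<le> d x"
  shows "computable (\<lambda>x. hole_pieces (d x) (cs x))"
  unfolding hole_pieces_def separating_def
  by (intro assms(1,2) assms(1,2)[THEN computable_comp] computable_intros computable_pieces computable_Least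
      computable_feasible computable_neg_vec ex_separating[unfolded separating_def]) (use assms(3) in blast)

subsection \<open>Matrices\<close>

abbreviation vec_coord :: "int vec \<Rightarrow> nat \<Rightarrow> int" where
  "vec_coord v \<equiv> coord (list_of_vec v)"

lemma vec_coord: "vec_coord v i = (if i < dim_vec v then v $ i else 0)"
  by (simp add: nth_default_def list_of_vec_index)

lemma vec_coord_inject:
  "u \<in> carrier_vec d \<Longrightarrow> v \<in> carrier_vec d \<Longrightarrow> vec_coord u = vec_coord v \<longleftrightarrow> u = v"
  by (auto simp: fun_eq_iff vec_coord intro!: eq_vecI split: if_splits)

lemma vec_coord_add:
  "u \<in> carrier_vec d \<Longrightarrow> v \<in> carrier_vec d \<Longrightarrow> vec_coord (u + v) = (\<lambda>i. vec_coord u i + vec_coord v i)"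
  by (auto simp: vec_coord)

lemma vec_coord_mult_mat_vec:
  assumes "A \<in> carrier_mat d n" "l \<in> carrier_vec n"
  shows "vec_coord (A *\<^sub>v l) = comb (($) l) (map vec_coord (cols A))"
proof
  fix i
  show "vec_coord (A *\<^sub>v l) i = comb (($) l) (map vec_coord (cols A)) i"
    using assms by (cases "i < d") (auto simp: vec_coord comb_def scalar_prod_def atLeast0LessThan intro!: sum.cong)
qed

lemma monoid_of_iff:
  assumes A: "A \<in> carrier_mat d n"
  shows "z \<in> monoid_of A \<longleftrightarrow> z \<in> carrier_vec d \<and> vec_coord z \<in> nspan (vec_coord ` set (cols A))"
proof -
  let ?cs = "map vec_coord (cols A)"
  have len: "length ?cs = n" using A by simp
  show ?thesis
  proof
    assume "z \<in> monoid_of A"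
    then obtain l where l: "l \<in> carrier_vec n" "\<forall>j<n. 0 \<le> l $ j" "z = A *\<^sub>v l"
      using A by (auto simp: monoid_of_def)
    then have "vec_coord z \<in> nspan (set ?cs)"
      unfolding l(3) vec_coord_mult_mat_vec[OF A l(1)] using len by (intro comb_in_nspan_set) auto
    then show "z \<in> carrier_vec d \<and> vec_coord z \<in> nspan (vec_coord ` set (cols A))"
      using A l by simp
  next
    assume z: "z \<in> carrier_vec d \<and> vec_coord z \<in> nspan (vec_coord ` set (cols A))"
    then obtain f where f: "\<And>j. 0 \<le> f j" "vec_coord z = comb f ?cs"
      using nspan_set_combE[of "vec_coord z" ?cs] by auto
    have "vec_coord (A *\<^sub>v vec n f) = vec_coord z"
      unfolding vec_coord_mult_mat_vec[OF A vec_carrier] f(2) using len by (simp add: comb_def)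
    then have "z = A *\<^sub>v vec n f" using A z by (subst (asm) vec_coord_inject[of _ d]) auto
    then show "z \<in> monoid_of A" unfolding monoid_of_def using A f(1)
      by (intro CollectI exI[of _ "vec n f"]) auto
  qed
qed

lemma lattice_of_iff:
  assumes A: "A \<in> carrier_mat d n"
  shows "z \<in> lattice_of A \<longleftrightarrow> z \<in> carrier_vec d \<and> (\<exists>a \<in> nspan (vec_coord ` set (cols A)).
    \<exists>b \<in> nspan (vec_coord ` set (cols A)). vec_coord z = (\<lambda>i. a i - b i))"
proof -
  let ?cs = "map vec_coord (cols A)"
  have len: "length ?cs = n" using A by simp
  have coeffs: "\<exists>f. (\<forall>j. 0 \<le> f j) \<and> a = comb f ?cs" if "a \<in> nspan (vec_coord ` set (cols A))" for a
    using nspan_set_combE[of a ?cs] that by (metis list.set_map)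
  show ?thesis
  proof
    assume "z \<in> lattice_of A"
    then obtain l where l: "l \<in> carrier_vec n" "z = A *\<^sub>v l"
      using A by (auto simp: lattice_of_def)
    \<comment> \<open>The positive and negative parts of l exhibit an integer combination as a
      difference of two nonnegative ones.\<close>
    have "comb (\<lambda>j. max (l $ j) 0) ?cs \<in> nspan (set ?cs)" "comb (\<lambda>j. max (- l $ j) 0) ?cs \<in> nspan (set ?cs)"
      by (intro comb_in_nspan_set; simp)+
    moreover have "vec_coord z = (\<lambda>i. comb (\<lambda>j. max (l $ j) 0) ?cs i - comb (\<lambda>j. max (- l $ j) 0) ?cs i)"
    proof
      have "max (l $ j) 0 - max (- l $ j) 0 = l $ j" for j by simp
      then show "vec_coord z i = comb (\<lambda>j. max (l $ j) 0) ?cs i - comb (\<lambda>j. max (- l $ j) 0) ?cs i" for i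
        unfolding l(2) vec_coord_mult_mat_vec[OF A l(1)] comb_diff[symmetric] by presburger
    qed
    ultimately show "z \<in> carrier_vec d \<and> (\<exists>a \<in> nspan (vec_coord ` set (cols A)).
       \<exists>b \<in> nspan (vec_coord ` set (cols A)). vec_coord z = (\<lambda>i. a i - b i))"
      using A l by auto
  next
    assume "z \<in> carrier_vec d \<and> (\<exists>a \<in> nspan (vec_coord ` set (cols A)).
       \<exists>b \<in> nspan (vec_coord ` set (cols A)). vec_coord z = (\<lambda>i. a i - b i))"
    then obtain a b where z: "z \<in> carrier_vec d" and ab: "a \<in> nspan (vec_coord ` set (cols A))"
      "b \<in> nspan (vec_coord ` set (cols A))" "vec_coord z = (\<lambda>i. a i - b i)" by blast
    obtain f g where fg: "a = comb f ?cs" "b = comb g ?cs" using coeffs ab by meson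
    have "vec_coord (A *\<^sub>v vec n (\<lambda>j. f j - g j)) = vec_coord z"
    proof
      have "comb (($) (vec n (\<lambda>j. f j - g j))) ?cs = comb (\<lambda>j. f j - g j) ?cs"
        using len by (simp add: comb_def)
      then show "vec_coord (A *\<^sub>v vec n (\<lambda>j. f j - g j)) i = vec_coord z i" for i
        unfolding vec_coord_mult_mat_vec[OF A vec_carrier] ab(3) fg by (simp add: comb_diff)
    qed
    then have "z = A *\<^sub>v vec n (\<lambda>j. f j - g j)" using A z by (subst (asm) vec_coord_inject[of _ d]) auto
    then show "z \<in> lattice_of A" unfolding lattice_of_def using A
      by (intro CollectI exI[of _ "vec n (\<lambda>j. f j - g j)"]) auto
  qed
qed

text \<open>Real coefficients become integral through \<open>rspan_int_multiple\<close>; conversely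
  the coefficients of k z are divided by k.\<close>

lemma cone_of_iff:
  assumes A: "A \<in> carrier_mat d n" and z: "z \<in> carrier_vec d"
  shows "map_vec real_of_int z \<in> cone_of A \<longleftrightarrow>
    (\<exists>k>0. (\<lambda>i. k * vec_coord z i) \<in> nspan (vec_coord ` set (cols A)))"
proof -
  let ?cs = "map vec_coord (cols A)" and ?C = "vec_coord ` set (cols A)"
  have len: "length ?cs = n" using A by simp
  have mult: "(map_mat real_of_int A *\<^sub>v l) $ i = (\<Sum>j<n. l $ j * real_of_int ((?cs ! j) i))"
    if "l \<in> carrier_vec n" "i < d" for l i
    using A that by (auto simp: scalar_prod_def vec_coord atLeast0LessThan mult.commute intro!: sum.cong)
  show ?thesis
  proof
    assume "map_vec real_of_int z \<in> cone_of A"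
    then obtain l where l: "l \<in> carrier_vec n" "\<forall>j<n. 0 \<le> l $ j"
      "map_vec real_of_int z = map_mat real_of_int A *\<^sub>v l" using A by (auto simp: cone_of_def)
    have C0: "c i = 0" if "c \<in> ?C" "d \<le> i" for c i
      using that A by (auto simp: vec_coord cols_def)
    have "real_of_int (vec_coord z i) = (\<Sum>j<n. l $ j * real_of_int ((?cs ! j) i))" for i
    proof (cases "i < d")
      case True
      then show ?thesis using mult[OF l(1) True] arg_cong[OF l(3), of "\<lambda>v. v $ i"] z by (simp add: vec_coord)
    next
      case False
      then have "(?cs ! j) i = 0" if "j < n" for j
        using that len nth_mem[of j ?cs] by (intro C0) auto
      then show ?thesis using False z by (simp add: vec_coord)
    qed
    then have "(\<lambda>i. real_of_int (vec_coord z i)) = (\<lambda>i. \<Sum>j<n. l $ j * real_of_int ((?cs ! j) i))" by blast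
    also have "\<dots> \<in> rspan ?C"
      using l(2) len nth_mem[of _ ?cs] by (intro rspan_sum) auto
    finally obtain k where "0 < k" "(\<lambda>i. k * vec_coord z i) \<in> nspan ?C"
      using rspan_int_multiple[of ?C d "vec_coord z"] C0 z by (auto simp: vec_coord)
    then show "\<exists>k>0. (\<lambda>i. k * vec_coord z i) \<in> nspan ?C" by blast
  next
    assume "\<exists>k>0. (\<lambda>i. k * vec_coord z i) \<in> nspan ?C"
    then obtain k where k: "0 < k" and "(\<lambda>i. k * vec_coord z i) \<in> nspan (set ?cs)" by auto
    from this(2) obtain f where f: "\<And>j. 0 \<le> f j" "(\<lambda>i. k * vec_coord z i) = comb f ?cs"
      by (rule nspan_set_combE) auto
    let ?l = "vec n (\<lambda>j. real_of_int (f j) / real_of_int k)"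
    have "map_vec real_of_int z = map_mat real_of_int A *\<^sub>v ?l"
    proof (rule eq_vecI)
      fix i assume "i < dim_vec (map_mat real_of_int A *\<^sub>v ?l)"
      then have i: "i < d" using A by simp
      have "real_of_int k * real_of_int (z $ i) = (\<Sum>j<n. real_of_int (f j) * real_of_int ((?cs ! j) i))"
        using arg_cong[OF fun_cong[OF f(2), of i], of real_of_int] i z len by (simp add: vec_coord comb_def)
      then have "real_of_int (z $ i) = (\<Sum>j<n. real_of_int (f j) * real_of_int ((?cs ! j) i)) / real_of_int k"
        using k by (simp add: field_simps)
      also have "\<dots> = (\<Sum>j<n. ?l $ j * real_of_int ((?cs ! j) i))"
        by (simp add: sum_divide_distrib)
      finally show "map_vec real_of_int z $ i = (map_mat real_of_int A *\<^sub>v ?l) $ i"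
        using mult[of ?l i] i z by simp
    qed (use A z in simp)
    then show "map_vec real_of_int z \<in> cone_of A"
      unfolding cone_of_def using A f(1) k by (intro CollectI exI[of _ ?l]) auto
  qed
qed

lemma holes_iff:
  assumes A: "A \<in> carrier_mat d n"
  shows "z \<in> holes A \<longleftrightarrow> z \<in> carrier_vec d \<and>
    vec_coord z \<in> sat_span (vec_coord ` set (cols A)) - nspan (vec_coord ` set (cols A))"
  using lattice_of_iff[OF A] cone_of_iff[OF A] monoid_of_iff[OF A]
  by (auto simp: holes_def saturation_def sat_span_def)

lemma represented_iff:
  assumes R: "well_dim d R"
  shows "z \<in> represented d R \<longleftrightarrow> z \<in> carrier_vec d \<and>
    (\<exists>(h, G) \<in> set R. \<exists>m \<in> nspan (vec_coord ` set G). vec_coord z = (\<lambda>i. vec_coord h i + m i))"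
proof -
  have "z \<in> {h + m | m. m \<in> monoid_of (mat_of_cols d G)} \<longleftrightarrow> z \<in> carrier_vec d \<and>
      (\<exists>m \<in> nspan (vec_coord ` set G). vec_coord z = (\<lambda>i. vec_coord h i + m i))" (is "?L \<longleftrightarrow> ?R")
    if "(h, G) \<in> set R" for h G
  proof -
    have h: "h \<in> carrier_vec d" and G: "set G \<subseteq> carrier_vec d" using R that by (auto simp: well_dim_def)
    have mono: "m \<in> monoid_of (mat_of_cols d G) \<longleftrightarrow> m \<in> carrier_vec d \<and> vec_coord m \<in> nspan (vec_coord ` set G)" for m
      using monoid_of_iff[of "mat_of_cols d G" d "length G" m] cols_mat_of_cols[OF G] by simp
    show ?thesis
    proof
      assume ?L
      then show ?R using h by (auto simp: mono vec_coord_add)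
    next
      assume R: ?R
      then obtain m where m: "m \<in> nspan (vec_coord ` set G)" "vec_coord z = (\<lambda>i. vec_coord h i + m i)"
        and z: "z \<in> carrier_vec d" by blast
      have "vec_coord (z - h) = m"
        using h z m(2) by (auto simp: fun_eq_iff vec_coord split: if_splits)
      then show ?L using h z m(1) by (intro CollectI exI[of _ "z - h"]) (auto simp: mono)
    qed
  qed
  then show ?thesis unfolding represented_def by blast
qed

theorem theorem2p1:
  "\<exists>algorithm :: recf. \<forall>(d::nat) (n::nat) (A::int mat).
     A \<in> carrier_mat d n \<and> pointed d (cone_of A) \<longrightarrow>
       (\<exists>R :: representation.
          run algorithm (encode_input A) = Some (encode_output R) \<and>
          well_dim d R \<and> holes A = represented d R)"
proof -
  \<comment> \<open>Every column is cut or padded to the stated length. \<open>computable\<close>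
    speaks about all pairs, including those with overlong columns, and this keeps the search total
    on them; on the columns of a matrix it is the identity.\<close>
  let ?cs = "\<lambda>I. map (\<lambda>c. lin2 (fst I) 1 c 0 []) (snd I)"
  have "computable (\<lambda>I :: nat \<times> int list list. hole_pieces (fst I) (?cs I))"
    by (intro computable_hole_pieces computable_intros computable_lin2) auto
  then obtain r where r: "\<And>I. run r [enc I] = Some (enc (hole_pieces (fst I) (?cs I)))"
    unfolding computable_def by blast
  \<comment> \<open>The input consists of two numbers, while \<open>r\<close> expects a single pair
    code; \<open>q\<close> does the packing.\<close>
  obtain q where q: "\<And>x y. run q [x, y] = Some (prod_encode (x, y))"
    using binary_prod_encode unfolding binary_def by blast
  show ?thesis
  proof (intro exI[of _ "Comp r [q]"] allI impI)
    fix d n A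
    assume "A \<in> carrier_mat d n \<and> pointed d (cone_of A)"
    then have A: "A \<in> carrier_mat d n" by simp
    let ?C = "map list_of_vec (cols A)"
    have len: "\<forall>c\<in>set ?C. length c = d" using A by (auto simp: cols_def)
    have "map (\<lambda>c. lin2 d 1 c 0 []) ?C = ?C"
    proof (rule map_idI)
      fix c assume "c \<in> set ?C"
      then have "length c = d" using len by blast
      then show "lin2 d 1 c 0 [] = c"
        using map_nth_default[of 0 c] by (simp add: lin2_def)
    qed
    then have norm: "?cs (d, ?C) = ?C" by simp
    let ?L = "hole_pieces d ?C"
    let ?R = "map (\<lambda>q. (vec_of_list (fst q), map vec_of_list (snd q))) ?L"
    have "enc (d, ?C) = prod_encode (d, encode_vecs (cols A))"
      by (simp add: enc_prod_def enc_list_def enc_int_def[abs_def] encode_vecs_def encode_vec_def[abs_def] comp_def)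
    moreover have "enc ?L = encode_output ?R"
      by (simp add: encode_output_def enc_prod_def[abs_def] enc_list_def[abs_def] enc_int_def[abs_def] encode_vecs_def
          encode_vec_def[abs_def] comp_def case_prod_beta list_vec)
    ultimately have run: "run (Comp r [q]) (encode_input A) = Some (encode_output ?R)"
      using r[of "(d, ?C)"] A unfolding norm by (simp add: encode_input_def q)
    have "vec_of_list (fst q) \<in> carrier_vec d \<and> set (map vec_of_list (snd q)) \<subseteq> carrier_vec d"
      if "q \<in> set ?L" for q
      using length_hole_pieces[OF len that] by (auto intro!: carrier_vecI)
    then have wd: "well_dim d ?R" unfolding well_dim_def by auto
    have "z \<in> holes A \<longleftrightarrow> z \<in> represented d ?R" for z
    proof -
      have "z \<in> represented d ?R \<longleftrightarrow> z \<in> carrier_vec d \<and>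
          (\<exists>q\<in>set ?L. \<exists>m\<in>nspan (coord ` set (snd q)). vec_coord z = (\<lambda>i. coord (fst q) i + m i))"
        unfolding represented_iff[OF wd] by (simp add: image_image list_vec)
      also have "\<dots> \<longleftrightarrow> z \<in> carrier_vec d \<and>
          vec_coord z \<in> sat_span (coord ` set ?C) - nspan (coord ` set ?C)"
        using hole_pieces_correct[of ?C d] len by simp
      also have "\<dots> \<longleftrightarrow> z \<in> holes A"
        unfolding holes_iff[OF A] by (simp add: image_image)
      finally show ?thesis by simp
    qed
    with run wd show "\<exists>R. run (Comp r [q]) (encode_input A) = Some (encode_output R) \<and>
        well_dim d R \<and> holes A = represented d R" by blast
  qed
qed

end
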